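(* Let $M$ be a closed oriented Riemannian three-manifold with a finite triangulation $K$, and let $C^1(K)=V_{\mathrm p}\oplus V_{\mathrm g}$ be the orthogonal splitting with $V_{\mathrm p}=\mathcal H^1_K\oplus\operatorname{im}\delta_1^\ast$ and $V_{\mathrm g}=\operatorname{im}\delta_0$; let $q=\dim V_{\mathrm g}$. Let $\mu=\mathcal N(m_\mu,\Sigma_\mu)$ and $\nu=\mathcal N(m_\nu,\Sigma_\nu)$ be nondegenerate Gaussian probability measures on $V_{\mathrm p}\oplus V_{\mathrm g}$ with $$m_\mu=\begin{pmatrix}m_{\mu,\mathrm p}\\ m_{\mu,\mathrm g}\end{pmatrix},\quad m_\nu=\begin{pmatrix}m_{\nu,\mathrm p}\\ m_{\nu,\mathrm g}\end{pmatrix},\quad \Sigma_\mu=\begin{pmatrix}A_\mu&B_\mu\\ B_\mu^\top&C_\mu\end{pmatrix},\quad \Sigma_\nu=\begin{pmatrix}A_\nu&B_\nu\\ B_\nu^\top&C_\nu\end{pmatrix}$$ in blocks relative to $V_{\mathrm p}\oplus V_{\mathrm g}$. Put $R_\mu=B_\mu^\top A_\mu^{-1}$, $R_\nu=B_\nu^\top A_\nu^{-1}$, $S_\mu=C_\mu-B_\mu^\top A_\mu^{-1}B_\mu$, $S_\nu=C_\nu-B_\nu^\top A_\nu^{-1}B_\nu$, $\Delta R=R_\mu-R_\nu$, and $$d=m_{\mu,\mathrm g}-m_{\nu,\mathrm g}-R_\nu\left(m_{\mu,\mathrm p}-m_{\nu,\mathrm p}\right).$$ Then the conditional gauge information $\mathcal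 I_{\mathrm g}(\mu,\nu)=\int_{V_{\mathrm p}}D\left(\mu_{\mathrm g|x}\,\middle\|\,\nu_{\mathrm g|x}\right)d\mu_{\mathrm p}(x)$ is given by $$\mathcal I_{\mathrm g}(\mu,\nu)=\frac12\left[\operatorname{Tr}(S_\nu^{-1}S_\mu)-q+\log\frac{\det S_\nu}{\det S_\mu}+d^\top S_\nu^{-1}d+\operatorname{Tr}\left(S_\nu^{-1}\,\Delta R\,A_\mu\,\Delta R^\top\right)\right].$$
   Context: $C^k(K)=C^k(K;\mathbb R)$ is the space of real simplicial $k$-cochains of $K$, $\delta_k:C^k(K)\to C^{k+1}(K)$ is the coboundary, and $W_k:C^k(K)\to\Omega^k_{\mathrm{pw}}(M)$ are the Whitney maps into piecewise smooth forms (the linear maps sending the cochain dual to an oriented simplex $[v_0,\dots,v_k]$ to $k!\sum_{i}(-1)^i\lambda_i\,d\lambda_0\wedge\cdots\wedge\widehat{d\lambda_i}\wedge\cdots\wedge d\lambda_k$, with $\lambda_i$ the barycentric coordinate function of $v_i$). Each $C^k(K)$ carries the Whitney inner product $\langle u,v\rangle_k=\int_M W_k(u)\wedge\star W_k(v)$, and $\delta_k^\ast$ denotes the adjoint of $\delta_k$ for these inner products. The harmonic space is $\mathcal H^1_K=\ker\delta_1\cap\ker\delta_0^\ast$, and one has the orthogonal discrete Hodge decomposition $C^1(K)=\operatorname{im}\delta_0\oplus\mathcal H^1_K\oplus\operatorname{im}\delta_1^\ast$. $P_{\mathrm p}:C^1(K)\to V_{\mathrm p}$ is the orthogonal projection onto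 $V_{\mathrm p}$ (with kernel $V_{\mathrm g}$); the physical marginals are the pushforwards $\mu_{\mathrm p}=(P_{\mathrm p})_\#\mu$, $\nu_{\mathrm p}=(P_{\mathrm p})_\#\nu$. Elements of $C^1(K)$ are written in Whitney-orthonormal coordinates as $a=(x,y)$ with $x\in V_{\mathrm p}$, $y\in V_{\mathrm g}$, and means and covariance matrices are taken in these coordinates. Nondegenerate means that the covariance matrix is positive definite. If $\mu$ has (Lebesgue) density $f(x,y)=f_{\mathrm p}(x)f_{\mathrm g|x}(y)$, where $f_{\mathrm p}$ is the density of $\mu_{\mathrm p}$, then $\mu_{\mathrm g|x}$ is the probability measure on $V_{\mathrm g}$ with density $f_{\mathrm g|x}=f(x,\cdot)/f_{\mathrm p}(x)$; similarly for $\nu$. For probability measures with densities $f,g$ the relative entropy is $D(f\|g)=\int f\log(f/g)$. *)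

theory Defs
  imports "HOL-Probability.Probability"
begin

section \<open>Linear algebra\<close>

definition pos_def :: "real ^ 'n ^ 'n \<Rightarrow> bool" where
  "pos_def A \<longleftrightarrow> transpose A = A \<and> (\<forall>x. x \<noteq> 0 \<longrightarrow> x \<bullet> (A *v x) > 0)"

definition block_vec :: "real ^ 'p \<Rightarrow> real ^ 'g \<Rightarrow> real ^ ('p + 'g)" where
  "block_vec x y = (\<chi> i. case i of Inl a \<Rightarrow> x $ a | Inr b \<Rightarrow> y $ b)"

definition block_mat ::
  "real ^ 'p ^ 'p \<Rightarrow> real ^ 'g ^ 'p \<Rightarrow> real ^ 'p ^ 'g \<Rightarrow> real ^ 'g ^ 'g \<Rightarrow> real ^ ('p + 'g) ^ ('p + 'g)" where
  "block_mat A B C D =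
     (\<chi> i. case i of Inl a \<Rightarrow> block_vec (A $ a) (B $ a) | Inr b \<Rightarrow> block_vec (C $ b) (D $ b))"

section \<open>Smooth maps\<close>

primrec Ck_on :: "nat \<Rightarrow> ('a::real_normed_vector \<Rightarrow> 'b::real_normed_vector) \<Rightarrow> 'a set \<Rightarrow> bool" where
  "Ck_on 0 f S \<longleftrightarrow> continuous_on S f"
| "Ck_on (Suc n) f S \<longleftrightarrow>
     (\<forall>x\<in>S. f differentiable (at x)) \<and> (\<forall>v. Ck_on n (\<lambda>x. frechet_derivative f (at x) v) S)"

text \<open>Only used for open \<open>S\<close> in finite-dimensional spaces.\<close>

definition smooth_on :: "'a::real_normed_vector set \<Rightarrow> ('a \<Rightarrow> 'b::real_normed_vector) \<Rightarrow> bool" where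
  "smooth_on S f \<longleftrightarrow> (\<forall>n. Ck_on n f S)"

section \<open>Exterior algebra\<close>

text \<open>A \<open>k\<close>-covector on \<open>'a\<close> is an alternating multilinear function of \<open>k\<close> vectors, given as a
  function on lists of length \<open>k\<close>.\<close>

type_synonym 'a covector = "'a list \<Rightarrow> real"

definition wedge :: "nat \<Rightarrow> nat \<Rightarrow> 'a covector \<Rightarrow> 'a covector \<Rightarrow> 'a covector" where
  "wedge k l \<alpha> \<beta> ws =
     (\<Sum>\<pi> | \<pi> permutes {..<k + l}. of_int (sign \<pi>)
        * \<alpha> (map (\<lambda>i. ws ! \<pi> i) [0..<k]) * \<beta> (map (\<lambda>i. ws ! \<pi> i) [k..<k + l])) / (fact k * fact l)"

definition wedge_list :: "('a \<Rightarrow> real) list \<Rightarrow> 'a covector" where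
  "wedge_list \<theta>s ws =
     (\<Sum>\<pi> | \<pi> permutes {..<length \<theta>s}. of_int (sign \<pi>) * (\<Prod>i<length \<theta>s. (\<theta>s ! i) (ws ! \<pi> i)))"

text \<open>Hodge star of a \<open>k\<close>-covector on \<open>real ^ 3\<close> for the inner product with Gram matrix \<open>G\<close>;
  \<open>\<epsilon> = 1\<close> or \<open>\<epsilon> = -1\<close> says whether the standard basis is positively oriented. In index notation:
  \<open>\<epsilon> \<surd>(det G) / k! * G\<^sup>i\<^sup>j \<cdots> \<beta>\<^sub>j\<^sub>\<dots> vol\<^sub>i\<^sub>\<dots>\<close>.\<close>

definition hodge_star ::
  "real \<Rightarrow> real ^ 3 ^ 3 \<Rightarrow> nat \<Rightarrow> (real ^ 3) covector \<Rightarrow> (real ^ 3) covector" where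
  "hodge_star \<epsilon> G k \<beta> ws =
     \<epsilon> * sqrt (det G) / fact k *
     (\<Sum>is | length is = k. \<Sum>js | length js = k.
        (\<Prod>r<k. matrix_inv G $ (is ! r) $ (js ! r)) * \<beta> (map (\<lambda>j. axis j 1) js)
        * det (vector (map (\<lambda>i. axis i 1) is @ ws) :: real ^ 3 ^ 3))"

definition pullback ::
  "('a::real_normed_vector \<Rightarrow> 'b::real_normed_vector) \<Rightarrow> ('b \<Rightarrow> 'b covector) \<Rightarrow> 'a \<Rightarrow> 'a covector" where
  "pullback f \<omega> s ws = \<omega> (f s) (map (frechet_derivative f (at s)) ws)"

section \<open>Triangulated closed oriented Riemannian three-manifolds\<close>

type_synonym 'm chart = "'m set \<times> ('m \<Rightarrow> real ^ 3)"

text \<open>The manifold is the whole type \<open>'m\<close>, the vertices of the complex are elements of the finite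
  type \<open>'v\<close>, and \<open>realize\<close> maps the geometric realization of \<open>faces\<close> in \<open>real ^ 'v\<close>
  (barycentric coordinates) to \<open>'m\<close>. The metric is given by its Gram matrix in each chart,
  as a function on the image of the chart.\<close>

record ('m, 'v::finite) triangulated_manifold =
  charts :: "'m chart set"
  metric :: "'m chart \<Rightarrow> real ^ 3 \<Rightarrow> real ^ 3 ^ 3"
  faces :: "'v set set"
  realize :: "real ^ 'v \<Rightarrow> 'm"

definition transition :: "'m chart \<Rightarrow> 'm chart \<Rightarrow> real ^ 3 \<Rightarrow> real ^ 3" where
  "transition c c' = snd c' \<circ> inv_into (fst c) (snd c)"

definition oriented_smooth_atlas :: "'m::t2_space chart set \<Rightarrow> bool" where
  "oriented_smooth_atlas \<A> \<longleftrightarrow>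
     (\<Union>c\<in>\<A>. fst c) = UNIV \<and>
     (\<forall>c\<in>\<A>. open (fst c) \<and> open (snd c ` fst c) \<and>
        homeomorphism (fst c) (snd c ` fst c) (snd c) (inv_into (fst c) (snd c))) \<and>
     (\<forall>c\<in>\<A>. \<forall>c'\<in>\<A>. smooth_on (snd c ` (fst c \<inter> fst c')) (transition c c') \<and>
        (\<forall>x\<in>snd c ` (fst c \<inter> fst c'). det (jacobian (transition c c') (at x)) > 0))"

definition riemannian_metric ::
  "'m chart set \<Rightarrow> ('m chart \<Rightarrow> real ^ 3 \<Rightarrow> real ^ 3 ^ 3) \<Rightarrow> bool" where
  "riemannian_metric \<A> g \<longleftrightarrow>
     (\<forall>c\<in>\<A>. smooth_on (snd c ` fst c) (g c) \<and> (\<forall>x\<in>snd c ` fst c. pos_def (g c x))) \<and>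
     (\<forall>c\<in>\<A>. \<forall>c'\<in>\<A>. \<forall>x\<in>snd c ` (fst c \<inter> fst c').
        g c x = transpose (jacobian (transition c c') (at x)) ** g c' (transition c c' x)
                ** jacobian (transition c c') (at x))"

definition simplicial_complex :: "'v set set \<Rightarrow> bool" where
  "simplicial_complex K \<longleftrightarrow>
     (\<forall>\<sigma>\<in>K. finite \<sigma> \<and> \<sigma> \<noteq> {} \<and> (\<forall>\<tau>. \<tau> \<subseteq> \<sigma> \<and> \<tau> \<noteq> {} \<longrightarrow> \<tau> \<in> K))"

definition closed_simplex :: "'v::finite set \<Rightarrow> (real ^ 'v) set" where
  "closed_simplex \<sigma> = {t. (\<forall>v. 0 \<le> t $ v) \<and> (\<Sum>v\<in>UNIV. t $ v) = 1 \<and> {v. t $ v \<noteq> 0} \<subseteq> \<sigma>}"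

definition realization :: "'v::finite set set \<Rightarrow> (real ^ 'v) set" where
  "realization K = (\<Union>\<sigma>\<in>K. closed_simplex \<sigma>)"

text \<open>Smooth triangulation: a homeomorphism that restricts to a smooth immersion of every closed
  simplex, i.e. near every point of the simplex it extends, in charts, to a smooth map whose
  derivative is injective on the tangent space of the simplex.\<close>

definition smooth_triangulation ::
  "'m::t2_space chart set \<Rightarrow> 'v::finite set set \<Rightarrow> (real ^ 'v \<Rightarrow> 'm) \<Rightarrow> bool" where
  "smooth_triangulation \<A> K h \<longleftrightarrow>
     simplicial_complex K \<and>
     (\<exists>h'. homeomorphism (realization K) UNIV h h') \<and>
     (\<forall>\<sigma>\<in>K. \<forall>t\<in>closed_simplex \<sigma>. \<forall>c\<in>\<A>. h t \<in> fst c \<longrightarrow>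
        (\<exists>N F. open N \<and> t \<in> N \<and> smooth_on N F \<and>
           (\<forall>s\<in>N \<inter> closed_simplex \<sigma>. h s \<in> fst c \<and> snd c (h s) = F s) \<and>
           (\<forall>w. w \<noteq> 0 \<and> (\<Sum>v\<in>UNIV. w $ v) = 0 \<and> {v. w $ v \<noteq> 0} \<subseteq> \<sigma> \<longrightarrow>
              frechet_derivative F (at t) w \<noteq> 0)))"

definition closed_oriented_riemannian_3manifold_triangulated ::
  "('m::t2_space, 'v::finite) triangulated_manifold \<Rightarrow> bool" where
  "closed_oriented_riemannian_3manifold_triangulated X \<longleftrightarrow>
     compact (UNIV :: 'm set) \<and> oriented_smooth_atlas (charts X) \<and>
     riemannian_metric (charts X) (metric X) \<and>
     smooth_triangulation (charts X) (faces X) (realize X)"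

section \<open>Cochains and Whitney forms\<close>

definition simplices :: "('m, 'v::finite) triangulated_manifold \<Rightarrow> nat \<Rightarrow> 'v set set" where
  "simplices X k = {\<sigma> \<in> faces X. card \<sigma> = Suc k}"

text \<open>Every simplex is oriented by the increasing order of its vertices, and a \<open>k\<close>-cochain is given
  by its values on the \<open>k\<close>-simplices with these orientations. The order on \<open>'v\<close> is an arbitrary
  linear order.\<close>

type_synonym 'v cochain = "(real, 'v set) vec"

definition cochains :: "('m, 'v::finite) triangulated_manifold \<Rightarrow> nat \<Rightarrow> 'v cochain set" where
  "cochains X k = {u. \<forall>\<sigma>. \<sigma> \<notin> simplices X k \<longrightarrow> u $ \<sigma> = 0}"

definition vert :: "'v::linorder set \<Rightarrow> nat \<Rightarrow> 'v" where
  "vert \<sigma> i = sorted_list_of_set \<sigma> ! i"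

definition coboundary ::
  "('m, 'v::{finite,linorder}) triangulated_manifold \<Rightarrow> nat \<Rightarrow> 'v cochain \<Rightarrow> 'v cochain" where
  "coboundary X k u =
     (\<chi> \<tau>. if \<tau> \<in> simplices X (Suc k) then \<Sum>i\<le>Suc k. (- 1) ^ i * u $ (\<tau> - {vert \<tau> i}) else 0)"

text \<open>Piecewise smooth forms are given on the closed simplices of the realization in \<open>real ^ 'v\<close>.
  There the barycentric coordinate function of \<open>v\<close> is \<open>\<lambda>t. t $ v\<close>, and its differential
  is \<open>\<lambda>w. w $ v\<close>.\<close>

definition whitney_form :: "'v::{finite,linorder} set \<Rightarrow> (real, 'v) vec \<Rightarrow> (real, 'v) vec covector" where
  "whitney_form \<sigma> t ws =
     (let k = card \<sigma> - 1 in
      fact k * (\<Sum>i\<le>k. (- 1) ^ i * t $ vert \<sigma> i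
        * wedge_list (map (\<lambda>j w. w $ vert \<sigma> j) (filter (\<lambda>j. j \<noteq> i) [0..<Suc k])) ws))"

definition whitney_map ::
  "('m, 'v::{finite,linorder}) triangulated_manifold \<Rightarrow> nat \<Rightarrow> 'v cochain
     \<Rightarrow> (real, 'v) vec \<Rightarrow> (real, 'v) vec covector" where
  "whitney_map X k u t ws = (\<Sum>\<sigma>\<in>simplices X k. u $ \<sigma> * whitney_form \<sigma> t ws)"

section \<open>The Whitney inner product\<close>

text \<open>Affine parametrization of a tetrahedron, respecting the order of the vertices.\<close>

definition ref_simplex :: "(real ^ 3) set" where
  "ref_simplex = {s. 0 < s $ 1 \<and> 0 < s $ 2 \<and> 0 < s $ 3 \<and> s $ 1 + s $ 2 + s $ 3 < 1}"

definition bary :: "'v::{finite,linorder} set \<Rightarrow> real ^ 3 \<Rightarrow> (real, 'v) vec" where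
  "bary \<sigma> s = (1 - s $ 1 - s $ 2 - s $ 3) *\<^sub>R axis (vert \<sigma> 0) 1 + s $ 1 *\<^sub>R axis (vert \<sigma> 1) 1
     + s $ 2 *\<^sub>R axis (vert \<sigma> 2) 1 + s $ 3 *\<^sub>R axis (vert \<sigma> 3) 1"

text \<open>The metric and the orientation of the manifold in the coordinates \<open>bary \<sigma>\<close>. They do not depend
  on the choice of the chart around the point.\<close>

definition chart_around :: "('m, 'v::finite) triangulated_manifold \<Rightarrow> 'm \<Rightarrow> 'm chart" where
  "chart_around X p = (SOME c. c \<in> charts X \<and> p \<in> fst c)"

definition simplex_chart ::
  "('m, 'v::{finite,linorder}) triangulated_manifold \<Rightarrow> 'v set \<Rightarrow> real ^ 3 \<Rightarrow> 'm chart" where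
  "simplex_chart X \<sigma> s = chart_around X (realize X (bary \<sigma> s))"

definition simplex_jacobian ::
  "('m, 'v::{finite,linorder}) triangulated_manifold \<Rightarrow> 'v set \<Rightarrow> real ^ 3 \<Rightarrow> real ^ 3 ^ 3" where
  "simplex_jacobian X \<sigma> s = jacobian (snd (simplex_chart X \<sigma> s) \<circ> realize X \<circ> bary \<sigma>) (at s)"

definition simplex_metric ::
  "('m, 'v::{finite,linorder}) triangulated_manifold \<Rightarrow> 'v set \<Rightarrow> real ^ 3 \<Rightarrow> real ^ 3 ^ 3" where
  "simplex_metric X \<sigma> s =
     (let c = simplex_chart X \<sigma> s; J = simplex_jacobian X \<sigma> s
      in transpose J ** metric X c (snd c (realize X (bary \<sigma> s))) ** J)"

definition simplex_orientation ::
  "('m, 'v::{finite,linorder}) triangulated_manifold \<Rightarrow> 'v set \<Rightarrow> real ^ 3 \<Rightarrow> real" where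
  "simplex_orientation X \<sigma> s = sgn (det (simplex_jacobian X \<sigma> s))"

text \<open>Integral of a piecewise smooth 3-form, given in the coordinates \<open>bary \<sigma>\<close> of each tetrahedron.\<close>

definition integral_3form ::
  "('m, 'v::{finite,linorder}) triangulated_manifold
     \<Rightarrow> ('v set \<Rightarrow> real ^ 3 \<Rightarrow> (real ^ 3) covector) \<Rightarrow> real" where
  "integral_3form X \<omega> =
     (\<Sum>\<sigma>\<in>simplices X 3. LINT s:ref_simplex|lborel.
        simplex_orientation X \<sigma> s * \<omega> \<sigma> s [axis 1 1, axis 2 1, axis 3 1])"

definition whitney_inner ::
  "('m, 'v::{finite,linorder}) triangulated_manifold \<Rightarrow> nat \<Rightarrow> 'v cochain \<Rightarrow> 'v cochain \<Rightarrow> real" where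
  "whitney_inner X k u v =
     integral_3form X (\<lambda>\<sigma> s.
       wedge k (3 - k) (pullback (bary \<sigma>) (whitney_map X k u) s)
         (hodge_star (simplex_orientation X \<sigma> s) (simplex_metric X \<sigma> s) k
            (pullback (bary \<sigma>) (whitney_map X k v) s)))"

section \<open>The discrete Hodge splitting\<close>

definition coboundary_adj ::
  "('m, 'v::{finite,linorder}) triangulated_manifold \<Rightarrow> nat \<Rightarrow> 'v cochain \<Rightarrow> 'v cochain" where
  "coboundary_adj X k v =
     (THE w. w \<in> cochains X k \<and>
        (\<forall>u\<in>cochains X k. whitney_inner X (Suc k) (coboundary X k u) v = whitney_inner X k u w))"

definition harmonic1 :: "('m, 'v::{finite,linorder}) triangulated_manifold \<Rightarrow> 'v cochain set" where
  "harmonic1 X = {a \<in> cochains X 1. coboundary X 1 a = 0 \<and> coboundary_adj X 0 a = 0}"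

definition phys_space :: "('m, 'v::{finite,linorder}) triangulated_manifold \<Rightarrow> 'v cochain set" where
  "phys_space X = {a + b |a b. a \<in> harmonic1 X \<and> b \<in> coboundary_adj X 1 ` cochains X 2}"

definition gauge_space :: "('m, 'v::{finite,linorder}) triangulated_manifold \<Rightarrow> 'v cochain set" where
  "gauge_space X = coboundary X 0 ` cochains X 0"

definition phys_proj ::
  "('m, 'v::{finite,linorder}) triangulated_manifold \<Rightarrow> 'v cochain \<Rightarrow> 'v cochain" where
  "phys_proj X a =
     (THE x. x \<in> phys_space X \<and> (\<forall>w\<in>phys_space X. whitney_inner X 1 (a - x) w = 0))"

definition whitney_orthonormal_basis ::
  "('m, 'v::{finite,linorder}) triangulated_manifold \<Rightarrow> 'v cochain set \<Rightarrow> ('n \<Rightarrow> 'v cochain) \<Rightarrow> bool" where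
  "whitney_orthonormal_basis X V e \<longleftrightarrow>
     (\<forall>i j. whitney_inner X 1 (e i) (e j) = (if i = j then 1 else 0)) \<and> span (range e) = V"

definition coords ::
  "('m, 'v::{finite,linorder}) triangulated_manifold \<Rightarrow> ('n::finite \<Rightarrow> 'v cochain) \<Rightarrow> 'v cochain
     \<Rightarrow> real ^ 'n" where
  "coords X e a = (\<chi> i. whitney_inner X 1 a (e i))"

definition coords2 ::
  "('m, 'v::{finite,linorder}) triangulated_manifold \<Rightarrow> ('p::finite \<Rightarrow> 'v cochain)
     \<Rightarrow> ('g::finite \<Rightarrow> 'v cochain) \<Rightarrow> 'v cochain \<Rightarrow> (real ^ 'p) \<times> (real ^ 'g)" where
  "coords2 X eP eG a = (coords X eP a, coords X eG a)"

section \<open>Gaussian measures and conditional gauge information\<close>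

definition gaussian_density :: "real ^ 'n \<Rightarrow> real ^ 'n ^ 'n \<Rightarrow> real ^ 'n \<Rightarrow> real" where
  "gaussian_density m \<Sigma> z =
     exp (- ((z - m) \<bullet> (matrix_inv \<Sigma> *v (z - m))) / 2) / sqrt ((2 * pi) ^ CARD('n) * det \<Sigma>)"

definition nondegenerate_gaussian ::
  "('m, 'v::{finite,linorder}) triangulated_manifold \<Rightarrow> ('p::finite \<Rightarrow> 'v cochain)
     \<Rightarrow> ('g::finite \<Rightarrow> 'v cochain) \<Rightarrow> 'v cochain measure
     \<Rightarrow> real ^ ('p + 'g) \<Rightarrow> real ^ ('p + 'g) ^ ('p + 'g) \<Rightarrow> bool" where
  "nondegenerate_gaussian X eP eG \<mu> m \<Sigma> \<longleftrightarrow>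
     pos_def \<Sigma> \<and> sets \<mu> = sets (restrict_space borel (cochains X 1)) \<and>
     distr \<mu> lborel (coords2 X eP eG) =
       density lborel (\<lambda>(x, y). ennreal (gaussian_density m \<Sigma> (block_vec x y)))"

definition phys_marginal ::
  "('m, 'v::{finite,linorder}) triangulated_manifold \<Rightarrow> 'v cochain measure \<Rightarrow> 'v cochain measure" where
  "phys_marginal X \<mu> = distr \<mu> (restrict_space borel (phys_space X)) (phys_proj X)"

definition joint_density ::
  "('m, 'v::{finite,linorder}) triangulated_manifold \<Rightarrow> ('p::finite \<Rightarrow> 'v cochain)
     \<Rightarrow> ('g::finite \<Rightarrow> 'v cochain) \<Rightarrow> 'v cochain measure \<Rightarrow> (real ^ 'p) \<times> (real ^ 'g) \<Rightarrow> real" where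
  "joint_density X eP eG \<mu> z = enn2real (RN_deriv lborel (distr \<mu> lborel (coords2 X eP eG)) z)"

definition phys_density ::
  "('m, 'v::{finite,linorder}) triangulated_manifold \<Rightarrow> ('p::finite \<Rightarrow> 'v cochain)
     \<Rightarrow> 'v cochain measure \<Rightarrow> real ^ 'p \<Rightarrow> real" where
  "phys_density X eP \<mu> x =
     enn2real (RN_deriv lborel (distr (phys_marginal X \<mu>) lborel (coords X eP)) x)"

text \<open>The measure on the gauge coordinates with density \<open>f(x,y) / f\<^sub>p(x)\<close>. Another version of the
  densities changes it only for \<open>x\<close> in a null set of the physical marginal.\<close>

definition gauge_conditional ::
  "('m, 'v::{finite,linorder}) triangulated_manifold \<Rightarrow> ('p::finite \<Rightarrow> 'v cochain)
     \<Rightarrow> ('g::finite \<Rightarrow> 'v cochain) \<Rightarrow> 'v cochain measure \<Rightarrow> real ^ 'p \<Rightarrow> (real ^ 'g) measure" where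
  "gauge_conditional X eP eG \<mu> x =
     density lborel (\<lambda>y. ennreal (joint_density X eP eG \<mu> (x, y) / phys_density X eP \<mu> x))"

text \<open>Relative entropy \<open>D(P \<parallel> Q)\<close>; \<open>KL_divergence\<close> takes the reference measure \<open>Q\<close> first.\<close>

definition relative_entropy :: "'a measure \<Rightarrow> 'a measure \<Rightarrow> real" where
  "relative_entropy P Q = KL_divergence (exp 1) Q P"

definition conditional_gauge_information ::
  "('m, 'v::{finite,linorder}) triangulated_manifold \<Rightarrow> ('p::finite \<Rightarrow> 'v cochain)
     \<Rightarrow> ('g::finite \<Rightarrow> 'v cochain) \<Rightarrow> 'v cochain measure \<Rightarrow> 'v cochain measure \<Rightarrow> real" where
  "conditional_gauge_information X eP eG \<mu> \<nu> =
     (LINT a|phys_marginal X \<mu>. relative_entropy (gauge_conditional X eP eG \<mu> (coords X eP a))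
        (gauge_conditional X eP eG \<nu> (coords X eP a)))"

text \<open>The integrals in the definition converge; a Bochner integral that does not would be 0.\<close>

definition gauge_information_converges ::
  "('m, 'v::{finite,linorder}) triangulated_manifold \<Rightarrow> ('p::finite \<Rightarrow> 'v cochain)
     \<Rightarrow> ('g::finite \<Rightarrow> 'v cochain) \<Rightarrow> 'v cochain measure \<Rightarrow> 'v cochain measure \<Rightarrow> bool" where
  "gauge_information_converges X eP eG \<mu> \<nu> \<longleftrightarrow>
     (AE a in phys_marginal X \<mu>.
        integrable (gauge_conditional X eP eG \<mu> (coords X eP a))
          (entropy_density (exp 1) (gauge_conditional X eP eG \<nu> (coords X eP a))
             (gauge_conditional X eP eG \<mu> (coords X eP a)))) \<and>
     integrable (phys_marginal X \<mu>)
       (\<lambda>a. relative_entropy (gauge_conditional X eP eG \<mu> (coords X eP a))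
          (gauge_conditional X eP eG \<nu> (coords X eP a)))"

end

theory Submission
  imports Defs
begin

text \<open>With respect to the splitting \<open>(x, y)\<close> a Gaussian density factors into the density of \<open>N(m\<^sub>p, A)\<close>
  at \<open>x\<close> times that of \<open>N(m\<^sub>g + R (x - m\<^sub>p), S)\<close> at \<open>y\<close>, so the gauge conditionals are Gaussians with constant
  covariances \<open>S\<^sub>\<mu>\<close>, \<open>S\<^sub>\<nu>\<close> whose means differ by \<open>d + \<Delta>R (x - m\<^sub>\<mu>\<^sub>p)\<close>. The relative entropy of two Gaussians
  is explicit, and integrating its quadratic dependence on that difference against \<open>N(m\<^sub>\<mu>\<^sub>p, A\<^sub>\<mu>)\<close> gives
  the last two terms of the formula.

  The geometry enters only through the bilinearity of the Whitney inner product, which makes coordinates linear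
  and identifies \<open>phys_proj\<close>. Additivity of the defining integrals needs integrability on the open tetrahedra;
  it follows by compactness, because the metric extends continuously and nondegenerately to the closed ones.\<close>

section \<open>Linear substitution in Lebesgue integrals\<close>

text \<open>Two features of the definitions shape the work. First, integrals are total and densities
  are fixed only up to null sets: a divergent Bochner integral is 0, and \<open>RN_deriv\<close> is
  one arbitrary version. Hence the computations carry \<open>has_bochner_integral\<close>, so that
  value and convergence come together. Second, the metric on a tetrahedron is read in a chart chosen
  separately at every point, so even measurability of the Whitney integrand has to be earned: near
  each point it is compared with one expression built from a single chart.

  On the analytic side everything reduces to one-dimensional normal moments. A factorization
  \<Sigma> = L L^T makes N(m, \<Sigma>) the image of a product of standard normals under x \<mapsto>
  m + L x. For this the substitution rule for linear maps is needed over arbitrary finite index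
  types; elementary matrices reduce it to shears, permutations and scalings of coordinates.\<close>

lemma nn_integral_lborel_vec_shear:
  fixes g :: "real ^ 'n \<Rightarrow> ennreal"
  assumes [measurable]: "g \<in> borel_measurable borel" and "m \<noteq> n"
  shows "(\<integral>\<^sup>+x. g (x + (c * x $ n) *\<^sub>R axis m 1) \<partial>lborel) = (\<integral>\<^sup>+x. g x \<partial>lborel)"
proof -
  interpret product_sigma_finite "\<lambda>b::real^'n. lborel :: real measure" ..
  let ?B = "Basis :: (real^'n) set" and ?a = "axis m 1 :: real^'n" and ?b = "axis n 1 :: real^'n"
  let ?s = "\<lambda>f. \<Sum>b\<in>?B. f b *\<^sub>R b :: real^'n"
  have B: "insert ?a (?B - {?a}) = ?B"
    by (auto simp: axis_in_Basis_iff)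
  have ab: "?b \<in> ?B" "?b \<noteq> ?a"
    using assms(2) by (auto simp: axis_in_Basis_iff axis_eq_axis)
  have nth: "?s f $ n = f ?b" for f
  proof -
    have "?s f $ n = ?s f \<bullet> ?b"
      by (simp add: inner_axis)
    also have "\<dots> = f ?b"
      by (simp add: inner_sum_left inner_Basis ab if_distrib sum.delta cong: if_cong)
    finally show ?thesis .
  qed
  have split: "?s (f(?a := y)) = y *\<^sub>R ?a + (\<Sum>b\<in>?B - {?a}. f b *\<^sub>R b)" for f y
    by (subst sum.remove[of _ ?a]) (auto simp: axis_in_Basis_iff intro!: sum.cong)
  have I: "(\<integral>\<^sup>+x. h x \<partial>lborel) = (\<integral>\<^sup>+f. \<integral>\<^sup>+y. h (?s (f(?a := y))) \<partial>lborel \<partial>Pi\<^sub>M (?B - {?a}) (\<lambda>_. lborel))"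
    if [measurable]: "h \<in> borel_measurable borel" for h :: "real^'n \<Rightarrow> ennreal"
    apply (subst lborel_eq)
    apply (subst nn_integral_distr)
      apply measurable
    apply (subst (1) B[symmetric])
    apply (subst product_nn_integral_insert)
    apply (auto simp: B)
    done
  \<comment> \<open>Once all coordinates other than \<open>m\<close> are frozen,
    \<open>x $ n\<close> is a constant because \<open>m \<noteq> n\<close>, so the shear only
    translates the innermost one-dimensional integral.\<close>
  have t: "(\<integral>\<^sup>+y. g ((y + d) *\<^sub>R ?a + v) \<partial>lborel) = (\<integral>\<^sup>+y. g (y *\<^sub>R ?a + v) \<partial>lborel)" for d v
    by (subst (2) nn_integral_real_affine[where c=1 and t=d]) (auto simp: add.commute)
  have "(\<integral>\<^sup>+y. g (?s (f(?a := y)) + (c * ?s (f(?a := y)) $ n) *\<^sub>R ?a) \<partial>lborel)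
    = (\<integral>\<^sup>+y. g (?s (f(?a := y))) \<partial>lborel)" for f
    unfolding nth unfolding split
    using ab t[of "c * f ?b" "\<Sum>b\<in>?B - {?a}. f b *\<^sub>R b"] by (simp add: algebra_simps)
  then show ?thesis
    by (subst (1 2) I) auto
qed

text \<open>Lebesgue measure is determined by its values on boxes; a coordinate permutation pulls a
  box back to a box with the same side lengths in another order.\<close>

lemma nn_integral_lborel_vec_permute:
  fixes g :: "real ^ 'n \<Rightarrow> ennreal"
  assumes [measurable]: "g \<in> borel_measurable borel" and "p permutes UNIV"
  shows "(\<integral>\<^sup>+x. g (\<chi> i. x $ p i) \<partial>lborel) = (\<integral>\<^sup>+x. g x \<partial>lborel)"
proof -
  let ?T = "\<lambda>x::real^'n. \<chi> i. x $ p i" and ?S = "\<lambda>x::real^'n. \<chi> i. x $ inv p i"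
  have bij: "bij p" using assms(2) by (rule permutes_bij)
  have [measurable]: "?T \<in> borel_measurable borel"
    by (intro borel_measurable_continuous_onI continuous_intros)
  have prd: "(\<Prod>b\<in>Basis. v \<bullet> b) = (\<Prod>i\<in>UNIV. v $ i)" for v :: "real^'n"
    by (simp add: Basis_vec_def inner_axis axis_eq_axis prod.UNION_disjoint)
  have "lborel = distr lborel borel ?T"
  proof (rule lborel_eqI)
    fix l u :: "real^'n" assume le: "\<And>b. b \<in> Basis \<Longrightarrow> l \<bullet> b \<le> u \<bullet> b"
    have "?T -` box l u = box (?S l) (?S u)"
      using bij by (auto simp: mem_box_cart) (metis bij_inv_eq_iff)+
    moreover have "(?S l) $ i \<le> (?S u) $ i" for i
      using le[of "axis (inv p i) 1"] by (simp add: axis_in_Basis_iff inner_axis)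
    ultimately have "emeasure (distr lborel borel ?T) (box l u) = ennreal (\<Prod>b\<in>Basis. (?S u - ?S l) \<bullet> b)"
      by (subst emeasure_distr) (auto simp: emeasure_lborel_box_eq Basis_vec_def inner_axis)
    also have "(\<Prod>b\<in>Basis. (?S u - ?S l) \<bullet> b) = (\<Prod>b\<in>Basis. (u - l) \<bullet> b)"
      unfolding prd using prod.permute[OF permutes_inv[OF assms(2)], of "\<lambda>i. (u - l) $ i"] by simp
    finally show "emeasure (distr lborel borel ?T) (box l u) = ennreal (\<Prod>b\<in>Basis. (u - l) \<bullet> b)" .
  qed simp
  then have "(\<integral>\<^sup>+x. g x \<partial>lborel) = (\<integral>\<^sup>+x. g x \<partial>distr lborel borel ?T)"
    by simp
  then show ?thesis
    by (simp add: nn_integral_distr)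
qed

text \<open>A shear arises from the identity by adding \<open>c\<close> times row \<open>n\<close>
  to row \<open>m\<close>, which leaves the determinant alone.\<close>

lemma det_shear:
  fixes m n :: "'n::finite"
  assumes "m \<noteq> n"
  shows "det (\<chi> i j. if i = m \<and> j = n then c else of_bool (i = j) :: real^'n^'n) = 1"
proof -
  have "(\<chi> i j. if i = m \<and> j = n then c else of_bool (i = j) :: real^'n^'n)
    = (\<chi> k. if k = m then row m (mat 1) + c *s row n (mat 1) else row k (mat 1))"
    using assms by (auto simp: vec_eq_iff row_def mat_def)
  then show ?thesis
    using det_row_operation[OF assms, of "mat 1 :: real^'n^'n" c] by simp
qed

lemma nn_integral_lborel_diagonal:
  fixes g :: "real ^ 'n \<Rightarrow> ennreal"
  assumes [measurable]: "g \<in> borel_measurable borel" and c: "\<And>i. c i \<noteq> 0"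
  shows "(\<integral>\<^sup>+x. g x \<partial>lborel) = ennreal \<bar>\<Prod>i\<in>UNIV. c i\<bar> * (\<integral>\<^sup>+x. g (\<chi> i. c i * x $ i) \<partial>lborel)"
proof -
  \<comment> \<open>\<open>lborel_affine_euclidean\<close> indexes the scaling factors by basis
    vectors; this functional takes the value \<open>c i\<close> at \<open>axis i 1\<close>.\<close>
  let ?c = "\<lambda>b::real^'n. \<Sum>i\<in>UNIV. c i * b $ i"
  have ca: "?c (axis i 1) = c i" for i
    by (simp add: axis_def if_distrib cong: if_cong)
  have nz: "?c j \<noteq> 0" if "j \<in> Basis" for j
    using that c ca by (auto simp: Basis_vec_def)
  have T: "0 + (\<Sum>j\<in>Basis. (?c j * (x \<bullet> j)) *\<^sub>R j) = (\<chi> i. c i * x $ i)" for x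
    by (simp add: Basis_vec_def axis_eq_axis sum.UNION_disjoint ca inner_axis)
       (simp add: vec_eq_iff axis_def if_distrib cong: if_cong)
  have P: "(\<Prod>j\<in>Basis. \<bar>?c j\<bar>) = \<bar>\<Prod>i\<in>UNIV. c i\<bar>"
    by (simp add: Basis_vec_def axis_eq_axis prod.UNION_disjoint ca abs_prod)
  have [measurable]: "(\<lambda>x::real^'n. \<chi> i. c i * x $ i) \<in> borel_measurable borel"
    by (intro borel_measurable_continuous_onI continuous_intros)
  have "lborel = density (distr lborel borel (\<lambda>x. \<chi> i. c i * x $ i)) (\<lambda>_. ennreal \<bar>\<Prod>i\<in>UNIV. c i\<bar>)"
    using lborel_affine_euclidean[of ?c 0, OF nz] unfolding T P .
  then have "(\<integral>\<^sup>+x. g x \<partial>lborel) = (\<integral>\<^sup>+x. g x \<partial>density (distr lborel borel (\<lambda>x. \<chi> i. c i * x $ i)) (\<lambda>_. ennreal \<bar>\<Prod>i\<in>UNIV. c i\<bar>))"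
    by simp
  then show ?thesis
    by (simp add: nn_integral_density nn_integral_distr nn_integral_cmult)
qed

text \<open>The library has this only for well-ordered index types.\<close>

lemma nn_integral_lborel_matrix:
  fixes g :: "real ^ 'n \<Rightarrow> ennreal" and A :: "real ^ 'n ^ 'n"
  assumes "g \<in> borel_measurable borel" and "det A \<noteq> 0"
  shows "(\<integral>\<^sup>+x. g x \<partial>lborel) = ennreal \<bar>det A\<bar> * (\<integral>\<^sup>+x. g (A *v x) \<partial>lborel)"
proof -
  have "\<forall>g \<in> borel_measurable borel. det A \<noteq> 0 \<longrightarrow>
    (\<integral>\<^sup>+x. g x \<partial>lborel) = ennreal \<bar>det A\<bar> * (\<integral>\<^sup>+x. g (A *v x) \<partial>lborel)"
  \<comment> \<open>The statement is quantified over \<open>g\<close> because the product case uses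
    it for \<open>B\<close> with the integrand \<open>\<lambda>x. g (A *v x)\<close>. Keeping
    \<open>det A \<noteq> 0\<close> as a premise makes the case of a zero row vacuous.\<close>
  proof (induction A rule: induct_matrix_elementary)
    case (1 A B)
    show ?case
    proof (intro ballI impI)
      fix g :: "real ^ 'n \<Rightarrow> ennreal"
      assume g[measurable]: "g \<in> borel_measurable borel" and d: "det (A ** B) \<noteq> 0"
      have [measurable]: "(*v) A \<in> borel_measurable borel"
        by (intro borel_measurable_continuous_onI) (simp add: linear_continuous_on linear_linear)
      have "(\<lambda>x. g (A *v x)) \<in> borel_measurable borel" by measurable
      moreover have "det A \<noteq> 0" "det B \<noteq> 0"
        using d by (auto simp: det_mul)
      ultimately show "(\<integral>\<^sup>+x. g x \<partial>lborel) = ennreal \<bar>det (A ** B)\<bar> * (\<integral>\<^sup>+x. g ((A ** B) *v x) \<partial>lborel)"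
        using 1 g by (simp add: det_mul abs_mult ennreal_mult mult.assoc matrix_vector_mul_assoc)
    qed
  next
    case (2 A i)
    then show ?case by (simp add: det_zero_row)
  next
    case (3 A)
    have det: "det A = (\<Prod>i\<in>UNIV. A $ i $ i)"
      using 3 by (rule det_diagonal)
    have mv: "A *v x = (\<chi> i. A $ i $ i * x $ i)" for x
    proof -
      have "(\<Sum>j\<in>UNIV. A $ i $ j * x $ j) = A $ i $ i * x $ i" for i
        using 3[of i] by (subst sum.remove[of _ i]) (auto intro!: sum.neutral)
      then show ?thesis
        by (simp add: vec_eq_iff matrix_vector_mult_def)
    qed
    show ?case
      unfolding mv det by (auto intro!: nn_integral_lborel_diagonal)
  next
    case (4 m n)
    let ?p = "Transposition.transpose m n"
    have p: "?p permutes UNIV"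
      by (rule permutes_swap_id) auto
    have "det (\<chi> i j. mat 1 $ i $ ?p j :: real^'n^'n) = of_int (sign ?p)"
      using det_permute_columns[OF p, of "mat 1 :: real^'n^'n"] by simp
    then have "\<bar>det (\<chi> i j. mat 1 $ i $ ?p j :: real^'n^'n)\<bar> = 1"
      by (simp add: sign_def)
    moreover have "(\<chi> i j. mat 1 $ i $ ?p j) *v x = (\<chi> i. x $ ?p i)" for x :: "real^'n"
    proof -
      have "(\<Sum>j\<in>UNIV. mat 1 $ i $ ?p j * x $ j) = x $ ?p i" for i
        by (subst sum.remove[of _ "?p i"]) (auto simp: mat_def split: if_splits intro!: sum.neutral)
      then show ?thesis
        by (simp add: vec_eq_iff matrix_vector_mult_def)
    qed
    ultimately show ?case
      using p by (simp add: nn_integral_lborel_vec_permute)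
  next
    case (5 m n c)
    have "(\<chi> i j. if i = m \<and> j = n then c else of_bool (i = j)) *v x = x + (c * x $ n) *\<^sub>R axis m 1"
      for x :: "real^'n"
    proof -
      have "(\<Sum>j\<in>UNIV. (if i = m \<and> j = n then c else of_bool (i = j)) * x $ j)
        = x $ i + (if i = m then c * x $ n else 0)" for i
      proof -
        have "(\<Sum>j\<in>UNIV. (if i = m \<and> j = n then c else of_bool (i = j)) * x $ j)
          = (\<Sum>j\<in>UNIV. (if i = j then x $ j else 0) + (if j = n then (if i = m then c * x $ n else 0) else 0))"
          using 5 by (intro sum.cong) auto
        then show ?thesis by (simp add: sum.distrib)
      qed
      then show ?thesis
        by (simp add: vec_eq_iff matrix_vector_mult_def axis_def)
    qed
    then show ?case
      using 5 by (simp add: det_shear nn_integral_lborel_vec_shear)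
  qed
  then show ?thesis
    using assms by blast
qed

section \<open>Positive definite matrices\<close>

lemma matrix_inv_right:
  fixes A :: "real ^ 'n ^ 'n"
  assumes "invertible A"
  shows "A ** matrix_inv A = mat 1"
  using assms unfolding invertible_def matrix_inv_def by (rule someI2_ex) simp

lemma matrix_inv_left:
  fixes A :: "real ^ 'n ^ 'n"
  assumes "invertible A"
  shows "matrix_inv A ** A = mat 1"
  using assms unfolding invertible_def matrix_inv_def by (rule someI2_ex) simp

lemma matrix_inv_unique:
  fixes A B :: "real ^ 'n ^ 'n"
  assumes "A ** B = mat 1"
  shows "matrix_inv A = B"
proof -
  have "invertible A"
    using assms by (auto simp: invertible_right_inverse)
  then have "matrix_inv A = matrix_inv A ** (A ** B)"
    using assms by simp
  also have "\<dots> = B"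
    using \<open>invertible A\<close> by (simp add: matrix_mul_assoc matrix_inv_left)
  finally show ?thesis .
qed

lemma pos_def_invertible:
  assumes "pos_def A"
  shows "invertible A"
proof -
  have "x = 0" if "A *v x = 0" for x
    using assms that by (force simp: pos_def_def)
  then show ?thesis
    by (simp add: invertible_left_inverse matrix_left_invertible_ker)
qed

lemma dot_matrix_vector_mult:
  fixes A :: "real ^ 'n ^ 'm"
  shows "x \<bullet> (A *v y) = (transpose A *v x) \<bullet> y"
  by (simp only: dot_lmul_matrix transpose_matrix_vector)

lemma transpose_mat_vec_dot:
  fixes A :: "real ^ 'n ^ 'm"
  shows "(A *v x) \<bullet> y = x \<bullet> (transpose A *v y)"
  by (metis dot_matrix_vector_mult inner_commute)

lemma matrix_inv_pos_def:
  assumes "pos_def A"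
  shows "pos_def (matrix_inv A)"
proof -
  note inv = pos_def_invertible[OF assms]
  have T: "transpose A = A"
    using assms by (simp add: pos_def_def)
  have "A ** transpose (matrix_inv A) = transpose (matrix_inv A ** A)"
    by (simp add: matrix_transpose_mul T)
  then have "A ** transpose (matrix_inv A) = mat 1"
    by (simp add: matrix_inv_left inv)
  then have sym: "transpose (matrix_inv A) = matrix_inv A"
    using matrix_inv_unique by metis
  moreover have "x \<bullet> (matrix_inv A *v x) > 0" if "x \<noteq> 0" for x
  proof -
    let ?y = "matrix_inv A *v x"
    have x: "x = A *v ?y"
      by (simp add: matrix_vector_mul_assoc matrix_inv_right inv)
    then have "?y \<noteq> 0" using that by auto
    then have "?y \<bullet> (A *v ?y) > 0" using assms by (simp add: pos_def_def)
    then show ?thesis using x by (metis inner_commute)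
  qed
  ultimately show ?thesis
    by (simp add: pos_def_def)
qed

text \<open>Gram-Schmidt for the inner product \<open>x \<bullet> (A *v y)\<close>: as long as fewer than \<open>CARD('n)\<close> vectors
  are chosen there is a nonzero one orthogonal to all of them.\<close>

lemma pos_def_orthonormal_family:
  fixes A :: "real ^ 'n ^ 'n"
  assumes "pos_def A"
  obtains v :: "'n \<Rightarrow> real ^ 'n" where "\<And>i j. v i \<bullet> (A *v v j) = (if i = j then 1 else 0)"
proof -
  have T: "transpose A = A"
    using assms by (simp add: pos_def_def)
  have sym: "x \<bullet> (A *v y) = y \<bullet> (A *v x)" for x y
    by (metis T dot_matrix_vector_mult inner_commute)
  have "finite S \<Longrightarrow> \<exists>v. \<forall>i\<in>S. \<forall>j\<in>S. v i \<bullet> (A *v v j) = (if i = j then 1 else 0)" for S :: "'n set"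
  proof (induction S rule: finite_induct)
    case (insert k S)
    then obtain v where v: "\<forall>i\<in>S. \<forall>j\<in>S. v i \<bullet> (A *v v j) = (if i = j then 1 else 0)"
      by blast
    have "dim ((\<lambda>i. A *v v i) ` S) \<le> card S"
      by (meson card_image_le dim_le_card finite_imageI insert.hyps(1) order_trans span_superset)
    also have "card S < CARD('n)"
      using insert.hyps by (metis UNIV_I finite_class.finite_UNIV psubset_card_mono subset_UNIV psubsetI)
    finally have "dim ((\<lambda>i. A *v v i) ` S) < DIM(real ^ 'n)"
      by simp
    then obtain x where x: "x \<noteq> 0" "\<And>y. y \<in> span ((\<lambda>i. A *v v i) ` S) \<Longrightarrow> orthogonal x y"
      by (rule orthogonal_to_subspace_exists) blast
    have xv: "x \<bullet> (A *v v i) = 0" if "i \<in> S" for i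
      using x(2)[of "A *v v i"] that by (simp add: orthogonal_def span_base)
    define r where "r = x \<bullet> (A *v x)"
    have "r > 0"
      using x(1) assms by (simp add: pos_def_def r_def)
    let ?w = "v(k := (1 / sqrt r) *\<^sub>R x)"
    have "?w i \<bullet> (A *v ?w j) = (if i = j then 1 else 0)" if "i \<in> insert k S" "j \<in> insert k S" for i j
      using that insert.hyps v xv sym[of "v i" x] \<open>r > 0\<close> r_def
      by (auto simp: matrix_vector_mult_scaleR)
    then show ?case by blast
  qed auto
  from this[of UNIV] show ?thesis
    using that by auto
qed

text \<open>An \<open>A\<close>-orthonormal family, taken as the rows of \<open>W\<close>, gives
  \<open>W ** (A ** transpose W) = mat 1\<close>, so \<open>L\<close> can be the inverse of
  \<open>W\<close>. It is not a triangular Cholesky factor; any square root of this kind maps the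
  standard Gaussian to one with covariance \<open>A\<close>.\<close>

lemma pos_def_factorization:
  fixes A :: "real ^ 'n ^ 'n"
  assumes "pos_def A"
  shows "\<exists>L :: real ^ 'n ^ 'n. A = L ** transpose L \<and> invertible L"
proof -
  obtain v :: "'n \<Rightarrow> real ^ 'n" where v: "\<And>i j. v i \<bullet> (A *v v j) = (if i = j then 1 else 0)"
    using pos_def_orthonormal_family[OF assms] by blast
  define W where "W = (\<chi> i. v i)"
  have "(W ** (A ** transpose W)) $ i $ j = v i \<bullet> (A *v v j)" for i j
    by (simp add: W_def matrix_matrix_mult_def matrix_vector_mult_def transpose_def inner_vec_def)
  then have WAW: "W ** (A ** transpose W) = mat 1"
    by (simp add: vec_eq_iff v mat_def)
  then have inv: "invertible W"
    by (auto simp: invertible_right_inverse)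
  define L where "L = matrix_inv W"
  have LW: "L ** W = mat 1" "W ** L = mat 1"
    by (simp_all add: L_def inv matrix_inv_left matrix_inv_right)
  have "transpose W ** transpose L = mat 1"
    using LW by (simp flip: matrix_transpose_mul)
  then have "A = (L ** W) ** A ** (transpose W ** transpose L)"
    by (simp add: LW)
  also have "\<dots> = L ** (W ** (A ** transpose W)) ** transpose L"
    by (simp add: matrix_mul_assoc)
  also have "\<dots> = L ** transpose L"
    by (simp add: WAW)
  finally have "A = L ** transpose L" .
  moreover have "invertible L"
    using LW by (auto simp: invertible_def)
  ultimately show ?thesis by blast
qed

lemma pos_def_det_pos:
  fixes A :: "real ^ 'n ^ 'n"
  assumes "pos_def A"
  shows "det A > 0"
proof -
  obtain L :: "real ^ 'n ^ 'n" where L: "A = L ** transpose L" "invertible L"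
    using pos_def_factorization[OF assms] by blast
  have "det A = det L * det L"
    unfolding L(1) det_mul by simp
  moreover have "det L \<noteq> 0"
    using L(2) by (simp add: invertible_det_nz)
  ultimately show ?thesis
    by (metis not_real_square_gt_zero)
qed

text \<open>Fubini for functions of single coordinates: it reduces mixed moments of independent
  coordinates to one-dimensional ones.\<close>

lemma has_bochner_integral_lborel_vec_prod:
  fixes f :: "'n::finite \<Rightarrow> real \<Rightarrow> real"
  assumes "\<And>i. has_bochner_integral lborel (f i) (I i)"
  shows "has_bochner_integral lborel (\<lambda>x::real^'n. \<Prod>i\<in>UNIV. f i (x $ i)) (\<Prod>i\<in>UNIV. I i)"
proof -
  interpret product_sigma_finite "\<lambda>b::real^'n. lborel :: real measure" ..
  let ?B = "Basis :: (real^'n) set"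
  let ?s = "\<lambda>h. \<Sum>b\<in>?B. h b *\<^sub>R b :: real^'n"
  \<comment> \<open>The product measure is indexed by basis vectors, the factors \<open>f i\<close>
    by indices; \<open>j\<close> recovers the index from \<open>axis i 1\<close>.\<close>
  define j where "j b = (THE i. b = axis i (1::real))" for b :: "real^'n"
  have j: "j (axis i 1) = i" for i
    by (auto simp: j_def axis_eq_axis)
  have f: "integrable lborel (f i)" "integral\<^sup>L lborel (f i) = I i" for i
    using assms[of i] by (auto simp: has_bochner_integral_iff)
  have [measurable]: "f i \<in> borel_measurable borel" for i
    using f(1)[of i] by auto
  have P: "(\<Prod>b\<in>?B. F b) = (\<Prod>i\<in>UNIV. F (axis i 1))" for F :: "real^'n \<Rightarrow> real"
    by (simp add: Basis_vec_def axis_eq_axis prod.UNION_disjoint)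
  have s: "?s h $ i = h (axis i 1)" for h i
    by (simp add: Basis_vec_def axis_eq_axis sum.UNION_disjoint)
       (simp add: axis_def if_distrib cong: if_cong)
  have *: "(\<Prod>i\<in>UNIV. f i (?s h $ i)) = (\<Prod>b\<in>?B. f (j b) (h b))" for h
    unfolding P s j ..
  have [measurable]: "?s \<in> borel_measurable (Pi\<^sub>M ?B (\<lambda>_. lborel))"
    by measurable
  have "integrable (Pi\<^sub>M ?B (\<lambda>_. lborel)) (\<lambda>h. \<Prod>b\<in>?B. f (j b) (h b))"
    by (intro product_integrable_prod f) auto
  moreover have "(\<integral>h. (\<Prod>b\<in>?B. f (j b) (h b)) \<partial>Pi\<^sub>M ?B (\<lambda>_. lborel)) = (\<Prod>i\<in>UNIV. I i)"
    by (subst product_integral_prod) (auto simp: f P j)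
  ultimately have "has_bochner_integral (Pi\<^sub>M ?B (\<lambda>_. lborel)) (\<lambda>h. \<Prod>i\<in>UNIV. f i (?s h $ i)) (\<Prod>i\<in>UNIV. I i)"
    unfolding * by (simp add: has_bochner_integral_iff)
  then have "integrable (Pi\<^sub>M ?B (\<lambda>_. lborel)) (\<lambda>h. \<Prod>i\<in>UNIV. f i (?s h $ i))"
    "(\<integral>h. (\<Prod>i\<in>UNIV. f i (?s h $ i)) \<partial>Pi\<^sub>M ?B (\<lambda>_. lborel)) = (\<Prod>i\<in>UNIV. I i)"
    unfolding has_bochner_integral_iff by blast+
  moreover have m: "(\<lambda>x::real^'n. \<Prod>i\<in>UNIV. f i (x $ i)) \<in> borel_measurable borel"
    by measurable
  moreover have sm: "?s \<in> Pi\<^sub>M ?B (\<lambda>_. lborel) \<rightarrow>\<^sub>M borel"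
    by measurable
  ultimately have "integrable (distr (Pi\<^sub>M ?B (\<lambda>_. lborel)) borel ?s) (\<lambda>x. \<Prod>i\<in>UNIV. f i (x $ i))"
    "(\<integral>x. (\<Prod>i\<in>UNIV. f i (x $ i)) \<partial>distr (Pi\<^sub>M ?B (\<lambda>_. lborel)) borel ?s) = (\<Prod>i\<in>UNIV. I i)"
    by (simp_all only: integrable_distr_eq[OF sm m] integral_distr[OF sm m])
  then show ?thesis
    unfolding has_bochner_integral_iff lborel_eq[where 'a="real^'n", symmetric] by blast
qed

section \<open>Gaussian measures\<close>

text \<open>Given as a density rather than as a product measure, so that it lives on
  \<open>real ^ 'n\<close> and the substitution rule for Lebesgue integrals applies
  directly.\<close>

definition std_gaussian :: "(real ^ 'n) measure" where
  "std_gaussian = density lborel (\<lambda>x. ennreal (\<Prod>i\<in>UNIV. std_normal_density (x $ i)))"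

lemma has_bochner_integral_std_gaussian:
  assumes [measurable]: "f \<in> borel_measurable borel"
    and "has_bochner_integral lborel (\<lambda>x. (\<Prod>i\<in>UNIV. std_normal_density (x $ i)) * f x) I"
  shows "has_bochner_integral std_gaussian f (I :: real)"
proof -
  have "has_bochner_integral (density lborel (\<lambda>x. ennreal (\<Prod>i\<in>UNIV. std_normal_density (x $ i)))) f I"
    using assms(2) by (intro has_bochner_integral_density) (auto intro!: prod_nonneg)
  then show ?thesis
    by (simp add: std_gaussian_def)
qed

lemma std_gaussian_moments:
  fixes k :: "'n::finite \<Rightarrow> nat"
  assumes "\<And>i. has_bochner_integral lborel (\<lambda>t. std_normal_density t * t ^ k i) (I i)"
  shows "has_bochner_integral std_gaussian (\<lambda>x. \<Prod>i\<in>UNIV. (x $ i) ^ k i) (\<Prod>i\<in>UNIV. I i)"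
  using has_bochner_integral_lborel_vec_prod[OF assms]
  by (intro has_bochner_integral_std_gaussian) (auto simp: prod.distrib)

lemma std_normal_moments_upto_2:
  "has_bochner_integral lborel (\<lambda>t. std_normal_density t * t ^ 0) 1"
  "has_bochner_integral lborel (\<lambda>t. std_normal_density t * t ^ 1) 0"
  "has_bochner_integral lborel (\<lambda>t. std_normal_density t * t ^ 2) 1"
  using std_normal_moment_even[of 0] std_normal_moment_odd[of 0] std_normal_moment_even[of 1] by auto

lemma prob_space_std_gaussian: "prob_space (std_gaussian :: (real ^ 'n) measure)"
proof -
  have h: "has_bochner_integral std_gaussian (\<lambda>x::real^'n. 1) (1::real)"
    using std_gaussian_moments[of "\<lambda>_::'n. 0" "\<lambda>_. 1"] std_normal_moments_upto_2(1) by simp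
  then have "(\<integral>\<^sup>+x. ennreal 1 \<partial>(std_gaussian :: (real ^ 'n) measure)) = ennreal 1"
    using nn_integral_eq_integral[of "std_gaussian :: (real ^ 'n) measure" "\<lambda>_. 1"]
    by (auto simp: has_bochner_integral_iff)
  then show ?thesis
    by (intro prob_spaceI) simp
qed

lemma std_gaussian_mean:
  "has_bochner_integral std_gaussian (\<lambda>x::real^'n. x $ i) 0"
proof -
  have "has_bochner_integral std_gaussian (\<lambda>x::real^'n. \<Prod>l\<in>UNIV. (x $ l) ^ (if l = i then 1 else 0))
      (\<Prod>l\<in>UNIV. (if l = i then 0 else 1))"
    using std_normal_moments_upto_2 by (intro std_gaussian_moments) auto
  moreover have "(\<Prod>l\<in>UNIV. (x $ l) ^ (if l = i then 1 else 0)) = x $ i" for x :: "real^'n"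
    by (simp add: if_distrib cong: if_cong)
  ultimately show ?thesis
    by (simp cong: if_cong)
qed

text \<open>Exponents are encoded as a function of the index: 2 at \<open>i\<close>, or 1 at both
  \<open>i\<close> and \<open>j\<close>. Off the diagonal the product of moments contains a first
  moment, which is 0.\<close>

lemma std_gaussian_covariance:
  "has_bochner_integral std_gaussian (\<lambda>x::real^'n. x $ i * x $ j) (if i = j then 1 else 0)"
proof (cases "i = j")
  case True
  have "has_bochner_integral std_gaussian (\<lambda>x::real^'n. \<Prod>l\<in>UNIV. (x $ l) ^ (if l = i then 2 else 0))
      (\<Prod>l\<in>(UNIV::'n set). 1)"
    using std_normal_moments_upto_2 by (intro std_gaussian_moments) auto
  moreover have "(\<Prod>l\<in>UNIV. (x $ l) ^ (if l = i then 2 else 0)) = x $ i * x $ i" for x :: "real^'n"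
    by (simp add: if_distrib power2_eq_square cong: if_cong)
  ultimately show ?thesis
    using True by simp
next
  case False
  have "has_bochner_integral std_gaussian (\<lambda>x::real^'n. \<Prod>l\<in>UNIV. (x $ l) ^ (if l = i \<or> l = j then 1 else 0))
      (\<Prod>l\<in>UNIV. (if l = i \<or> l = j then 0 else 1))"
    using std_normal_moments_upto_2 by (intro std_gaussian_moments) auto
  moreover have "(\<Prod>l\<in>UNIV. (x $ l) ^ (if l = i \<or> l = j then 1 else 0)) = x $ i * x $ j" for x :: "real^'n"
  proof -
    have "(\<Prod>l\<in>UNIV. (x $ l) ^ (if l = i \<or> l = j then 1 else 0))
      = (\<Prod>l\<in>UNIV. (if l = i then x $ l else 1) * (if l = j then x $ l else 1))"
      using False by (intro prod.cong) auto
    then show ?thesis by (simp add: prod.distrib)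
  qed
  moreover have "(\<Prod>l\<in>UNIV. (if l = i \<or> l = j then 0 else (1::real))) = 0"
    by (auto intro!: prod_zero)
  ultimately show ?thesis
    using False by simp
qed

definition gaussian :: "real ^ 'n \<Rightarrow> real ^ 'n ^ 'n \<Rightarrow> (real ^ 'n) measure" where
  "gaussian m \<Sigma> = density lborel (\<lambda>z. ennreal (gaussian_density m \<Sigma> z))"

lemma gaussian_density_pos: "pos_def \<Sigma> \<Longrightarrow> gaussian_density m \<Sigma> z > 0"
  using pos_def_det_pos[of \<Sigma>] by (simp add: gaussian_density_def)

lemma borel_measurable_matrix_vector_mult [measurable (raw)]:
  fixes A :: "real ^ 'n ^ 'm"
  assumes "f \<in> borel_measurable M"
  shows "(\<lambda>x. A *v f x) \<in> borel_measurable M"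
  using assms by (rule borel_measurable_continuous_on[rotated]) (simp add: linear_continuous_on linear_linear)

lemma borel_measurable_gaussian_density [measurable]:
  "gaussian_density m \<Sigma> \<in> borel_measurable borel"
  unfolding gaussian_density_def[abs_def] by measurable

text \<open>Substituting z = m + L x reduces the quadratic form to \<open>x \<bullet> x\<close>, and
  the Jacobian \<open>\<bar>det L\<bar>\<close> cancels the square root of
  \<open>det \<Sigma>\<close>.\<close>

lemma gaussian_density_affine:
  fixes L :: "real ^ 'n ^ 'n"
  assumes "\<Sigma> = L ** transpose L" "invertible L"
  shows "\<bar>det L\<bar> * gaussian_density m \<Sigma> (m + L *v x) = (\<Prod>i\<in>UNIV. std_normal_density (x $ i))"
proof -
  define W where "W = matrix_inv L"
  have WL: "W ** L = mat 1" "L ** W = mat 1"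
    by (simp_all add: W_def assms(2) matrix_inv_left matrix_inv_right)
  have "transpose L ** transpose W = mat 1"
    using WL by (simp flip: matrix_transpose_mul)
  then have "L ** (transpose L ** transpose W) ** W = mat 1"
    by (simp add: WL)
  then have "\<Sigma> ** (transpose W ** W) = mat 1"
    by (simp add: assms(1) matrix_mul_assoc)
  then have "matrix_inv \<Sigma> = transpose W ** W"
    by (rule matrix_inv_unique)
  then have "(L *v x) \<bullet> (matrix_inv \<Sigma> *v (L *v x)) = (L *v x) \<bullet> (transpose W *v (W *v (L *v x)))"
    by (simp only: matrix_vector_mul_assoc matrix_mul_assoc)
  also have "\<dots> = (W *v (L *v x)) \<bullet> (W *v (L *v x))"
    unfolding dot_matrix_vector_mult[of _ "transpose W"] transpose_transpose ..
  also have "\<dots> = x \<bullet> x"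
    by (simp add: matrix_vector_mul_assoc WL)
  finally have Q: "(L *v x) \<bullet> (matrix_inv \<Sigma> *v (L *v x)) = x \<bullet> x" .
  have d: "sqrt ((2 * pi) ^ CARD('n) * det \<Sigma>) = sqrt (2 * pi) ^ CARD('n) * \<bar>det L\<bar>"
    by (simp add: assms(1) det_mul real_sqrt_mult real_sqrt_power power_mult_distrib)
  have dn: "\<bar>det L\<bar> > 0"
    using assms(2) by (simp add: invertible_det_nz)
  have "(\<Prod>i\<in>UNIV. std_normal_density (x $ i)) = exp (\<Sum>i\<in>UNIV. - (x $ i)\<^sup>2 / 2) / sqrt (2 * pi) ^ CARD('n)"
    by (simp add: std_normal_density_def prod_dividef exp_sum)
  also have "(\<Sum>i\<in>UNIV. - (x $ i)\<^sup>2 / 2) = - (x \<bullet> x) / 2"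
    by (simp add: inner_vec_def power2_eq_square sum_negf flip: sum_divide_distrib)
  finally show ?thesis
    using dn unfolding gaussian_density_def d by (simp add: Q)
qed

text \<open>Translation followed by linear substitution. With it, total mass and moments of any
  nondegenerate Gaussian are computed under the standard one.\<close>

lemma gaussian_eq_distr_std_gaussian:
  fixes L :: "real ^ 'n ^ 'n"
  assumes \<Sigma>: "\<Sigma> = L ** transpose L" "invertible L"
  shows "gaussian m \<Sigma> = distr std_gaussian borel (\<lambda>x. m + L *v x)"
proof (rule measure_eqI)
  fix A assume "A \<in> sets (gaussian m \<Sigma>)"
  then have A[measurable]: "A \<in> sets borel"
    by (simp add: gaussian_def)
  have det: "det L \<noteq> 0" using assms(2) by (simp add: invertible_det_nz)
  have T: "(\<lambda>x. m + L *v x) \<in> borel \<rightarrow>\<^sub>M borel"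
    by measurable
  have V: "(\<lambda>x. m + L *v x) -` A \<in> sets borel"
    using measurable_sets[OF T A] by simp
  let ?g = "\<lambda>z. ennreal (gaussian_density m \<Sigma> z) * indicator A z"
  have "emeasure (gaussian m \<Sigma>) A = (\<integral>\<^sup>+z. ?g z \<partial>lborel)"
    by (simp add: gaussian_def emeasure_density)
  also have "\<dots> = (\<integral>\<^sup>+z. ?g z \<partial>distr lborel borel ((+) m))"
    by (simp add: lborel_distr_plus)
  also have "\<dots> = (\<integral>\<^sup>+z. ?g (m + z) \<partial>lborel)"
    by (simp add: nn_integral_distr)
  also have "\<dots> = ennreal \<bar>det L\<bar> * (\<integral>\<^sup>+x. ?g (m + L *v x) \<partial>lborel)"
    by (rule nn_integral_lborel_matrix[OF _ det]) measurable
  also have "\<dots> = (\<integral>\<^sup>+x. ennreal \<bar>det L\<bar> * ?g (m + L *v x) \<partial>lborel)"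
    by (simp add: nn_integral_cmult)
  also have "\<dots> = (\<integral>\<^sup>+x. ennreal (\<Prod>i\<in>UNIV. std_normal_density (x $ i)) * indicator A (m + L *v x) \<partial>lborel)"
    by (simp add: gaussian_density_affine[OF \<Sigma>, of m, symmetric] ennreal_mult' mult.assoc)
  also have "\<dots> = emeasure (distr std_gaussian borel (\<lambda>x. m + L *v x)) A"
    using V by (subst emeasure_distr) (auto simp: std_gaussian_def emeasure_density indicator_def)
  finally show "emeasure (gaussian m \<Sigma>) A = emeasure (distr std_gaussian borel (\<lambda>x. m + L *v x)) A" .
qed (simp add: gaussian_def)

lemma sets_gaussian [simp, measurable_cong]: "sets (gaussian m \<Sigma>) = sets borel"
  by (simp add: gaussian_def)

lemma space_gaussian [simp]: "space (gaussian m \<Sigma>) = UNIV"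
  by (simp add: gaussian_def)

lemma sets_std_gaussian [simp, measurable_cong]: "sets std_gaussian = sets borel"
  by (simp add: std_gaussian_def)

lemma prob_space_gaussian:
  fixes \<Sigma> :: "real ^ 'n ^ 'n"
  assumes "pos_def \<Sigma>"
  shows "prob_space (gaussian m \<Sigma>)"
proof -
  obtain L :: "real ^ 'n ^ 'n" where L: "\<Sigma> = L ** transpose L" "invertible L"
    using pos_def_factorization[OF assms] by blast
  show ?thesis
    unfolding gaussian_eq_distr_std_gaussian[OF L]
    by (rule prob_space.prob_space_distr[OF prob_space_std_gaussian]) measurable
qed

lemma trace_mult_transpose:
  fixes M :: "real ^ 'n ^ 'n"
  shows "trace (M ** (L ** transpose L)) = trace (transpose L ** M ** L)"
  by (metis matrix_mul_assoc trace_mul_sym)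

text \<open>The centre \<open>a\<close> is kept apart from the mean \<open>m\<close> because
  relative entropy integrates the quadratic form of one Gaussian against another. In standard
  coordinates only the diagonal of \<open>N\<close> survives, and
  \<open>trace N = trace (M ** \<Sigma>)\<close> by cyclicity.\<close>

lemma gaussian_quadratic:
  fixes M :: "real ^ 'n ^ 'n"
  assumes "pos_def \<Sigma>"
  shows "has_bochner_integral (gaussian m \<Sigma>) (\<lambda>z. (z - a) \<bullet> (M *v (z - a)))
    (trace (M ** \<Sigma>) + (m - a) \<bullet> (M *v (m - a)))"
proof -
  obtain L :: "real ^ 'n ^ 'n" where L: "\<Sigma> = L ** transpose L" "invertible L"
    using pos_def_factorization[OF assms] by blast
  define N where "N = transpose L ** M ** L"
  \<comment> \<open>\<open>M\<close> is a general matrix, so the two cross terms contribute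
    \<open>M\<close> and its transpose separately.\<close>
  define b where "b = transpose L *v (M *v (m - a)) + transpose L *v (transpose M *v (m - a))"
  have quad: "(m + L *v x - a) \<bullet> (M *v (m + L *v x - a))
    = (\<Sum>i\<in>UNIV. \<Sum>j\<in>UNIV. N $ i $ j * (x $ i * x $ j)) + (\<Sum>i\<in>UNIV. b $ i * x $ i)
      + (m - a) \<bullet> (M *v (m - a)) * 1" for x
  proof -
    let ?e = "m - a"
    have "(m + L *v x - a) \<bullet> (M *v (m + L *v x - a)) = (L *v x + ?e) \<bullet> (M *v (L *v x + ?e))"
      by (simp add: algebra_simps)
    also have "\<dots> = (L *v x) \<bullet> (M *v (L *v x)) + ((L *v x) \<bullet> (M *v ?e) + ?e \<bullet> (M *v (L *v x))) + ?e \<bullet> (M *v ?e)"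
      unfolding matrix_vector_right_distrib inner_add_left inner_add_right by simp
    also have "(L *v x) \<bullet> (M *v (L *v x)) = x \<bullet> (N *v x)"
      unfolding N_def transpose_mat_vec_dot[of L] by (simp only: matrix_vector_mul_assoc matrix_mul_assoc)
    also have "\<dots> = (\<Sum>i\<in>UNIV. \<Sum>j\<in>UNIV. N $ i $ j * (x $ i * x $ j))"
      by (simp add: inner_vec_def matrix_vector_mult_def sum_distrib_left ac_simps)
    also have "(L *v x) \<bullet> (M *v ?e) + ?e \<bullet> (M *v (L *v x)) = b \<bullet> x"
    proof -
      have "?e \<bullet> (M *v (L *v x)) = (transpose L *v (transpose M *v ?e)) \<bullet> x"
        by (simp only: dot_matrix_vector_mult)
      moreover have "(L *v x) \<bullet> (M *v ?e) = (transpose L *v (M *v ?e)) \<bullet> x"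
        by (simp only: transpose_mat_vec_dot[of L] inner_commute[of x])
      ultimately show ?thesis
        by (simp only: b_def inner_add_left)
    qed
    also have "b \<bullet> x = (\<Sum>i\<in>UNIV. b $ i * x $ i)"
      by (simp add: inner_vec_def)
    finally show ?thesis by simp
  qed
  have one: "has_bochner_integral std_gaussian (\<lambda>x::real^'n. 1) (1::real)"
    using std_gaussian_moments[of "\<lambda>_::'n. 0" "\<lambda>_. 1"] std_normal_moments_upto_2(1) by simp
  have "has_bochner_integral std_gaussian (\<lambda>x. (m + L *v x - a) \<bullet> (M *v (m + L *v x - a)))
    ((\<Sum>i\<in>UNIV. \<Sum>j\<in>UNIV. N $ i $ j * (if i = j then 1 else 0)) + (\<Sum>i\<in>UNIV. b $ i * 0)
      + (m - a) \<bullet> (M *v (m - a)) * 1)"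
    unfolding quad
    by (intro has_bochner_integral_add has_bochner_integral_sum has_bochner_integral_mult_right
        std_gaussian_covariance std_gaussian_mean one)
  moreover have "(\<Sum>i\<in>UNIV. \<Sum>j\<in>UNIV. N $ i $ j * (if i = j then 1 else 0)) = trace (M ** \<Sigma>)"
    unfolding L(1) trace_mult_transpose by (simp add: N_def trace_def if_distrib cong: if_cong)
  ultimately have "has_bochner_integral std_gaussian (\<lambda>x. (m + L *v x - a) \<bullet> (M *v (m + L *v x - a)))
    (trace (M ** \<Sigma>) + (m - a) \<bullet> (M *v (m - a)))"
    by simp
  then show ?thesis
    unfolding gaussian_eq_distr_std_gaussian[OF L]
    by (simp add: has_bochner_integral_iff integrable_distr_eq integral_distr)
qed

lemma gaussian_mean:
  fixes m :: "real ^ 'n"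
  assumes "pos_def \<Sigma>"
  shows "has_bochner_integral (gaussian m \<Sigma>) (\<lambda>z. b \<bullet> (z - m)) 0"
proof -
  obtain L :: "real ^ 'n ^ 'n" where L: "\<Sigma> = L ** transpose L" "invertible L"
    using pos_def_factorization[OF assms] by blast
  have "b \<bullet> (L *v x) = (\<Sum>i\<in>UNIV. (transpose L *v b) $ i * x $ i)" for x
    unfolding dot_matrix_vector_mult[of b L] by (simp add: inner_vec_def del: transpose_matrix_vector)
  moreover have "has_bochner_integral std_gaussian (\<lambda>x. \<Sum>i\<in>UNIV. (transpose L *v b) $ i * x $ i) (\<Sum>i\<in>UNIV. (transpose L *v b) $ i * 0)"
    by (intro has_bochner_integral_sum has_bochner_integral_mult_right std_gaussian_mean)
  ultimately have "has_bochner_integral std_gaussian (\<lambda>x. b \<bullet> (m + L *v x - m)) 0"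
    by simp
  then show ?thesis
    unfolding gaussian_eq_distr_std_gaussian[OF L]
    by (simp add: has_bochner_integral_iff integrable_distr_eq integral_distr)
qed

text \<open>The cross terms are linear in \<open>z - m\<close> and integrate to 0. The purely
  quadratic part has matrix \<open>transpose K ** M ** K\<close>; cyclicity of the trace brings its
  average into the shape used in the final formula.\<close>

lemma gaussian_affine_quadratic:
  fixes K :: "real ^ 'n ^ 'k" and M :: "real ^ 'k ^ 'k" and m :: "real ^ 'n"
  assumes "pos_def \<Sigma>"
  shows "has_bochner_integral (gaussian m \<Sigma>) (\<lambda>z. (v + K *v (z - m)) \<bullet> (M *v (v + K *v (z - m))))
    (v \<bullet> (M *v v) + trace (M ** K ** \<Sigma> ** transpose K))"
proof -
  interpret prob_space "gaussian m \<Sigma>"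
    using assms by (rule prob_space_gaussian)
  let ?N = "transpose K ** M ** K"
  let ?b = "transpose K *v (M *v v) + transpose K *v (transpose M *v v)"
  have expand: "(v + K *v x) \<bullet> (M *v (v + K *v x)) = v \<bullet> (M *v v) + ?b \<bullet> x + x \<bullet> (?N *v x)" for x
  proof -
    have "(K *v x) \<bullet> (M *v (K *v x)) = x \<bullet> (?N *v x)"
      unfolding transpose_mat_vec_dot[of K] by (simp only: matrix_vector_mul_assoc matrix_mul_assoc)
    moreover have "v \<bullet> (M *v (K *v x)) = (transpose K *v (transpose M *v v)) \<bullet> x"
      by (simp only: dot_matrix_vector_mult)
    moreover have "(K *v x) \<bullet> (M *v v) = (transpose K *v (M *v v)) \<bullet> x"
      by (simp only: transpose_mat_vec_dot[of K] inner_commute[of x])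
    ultimately show ?thesis
      by (simp only: matrix_vector_right_distrib inner_add_left inner_add_right)
  qed
  have c: "has_bochner_integral (gaussian m \<Sigma>) (\<lambda>_. v \<bullet> (M *v v)) (v \<bullet> (M *v v))"
    using prob_space by (simp add: has_bochner_integral_iff)
  have "has_bochner_integral (gaussian m \<Sigma>) (\<lambda>z. v \<bullet> (M *v v) + ?b \<bullet> (z - m) + (z - m) \<bullet> (?N *v (z - m)))
    (v \<bullet> (M *v v) + 0 + (trace (?N ** \<Sigma>) + (m - m) \<bullet> (?N *v (m - m))))"
    by (intro has_bochner_integral_add c gaussian_mean gaussian_quadratic assms)
  moreover have "trace (?N ** \<Sigma>) = trace (M ** K ** \<Sigma> ** transpose K)"
    by (metis matrix_mul_assoc trace_mul_sym)
  ultimately show ?thesis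
    unfolding expand by simp
qed

section \<open>Relative entropy of densities\<close>

text \<open>Uniqueness of \<open>RN_deriv\<close> gives the quotient almost everywhere for
  \<open>density M f\<close>; \<open>ac\<close> transfers this to \<open>density M g\<close>, the
  measure against which the entropy is integrated.\<close>

lemma (in sigma_finite_measure) entropy_density_density_density:
  fixes f g :: "'a \<Rightarrow> real"
  assumes f: "f \<in> borel_measurable M" "\<And>x. 0 \<le> f x"
    and g: "g \<in> borel_measurable M" "\<And>x. 0 \<le> g x"
    and ac: "AE x in M. f x = 0 \<longrightarrow> g x = 0"
  shows "AE x in density M g. entropy_density b (density M f) (density M g) x = log b (g x / f x)"
proof -
  interpret Mf: sigma_finite_measure "density M f"
    using f by (subst sigma_finite_iff_density_finite) auto
  have eq: "density (density M f) (\<lambda>x. g x / f x) = density M g"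
    using f g ac by (intro density_density_divide) auto
  have "AE x in density M f. ennreal (g x / f x) = RN_deriv (density M f) (density M g) x"
    using f g eq by (intro Mf.RN_deriv_unique) auto
  then have "AE x in M. 0 < f x \<longrightarrow> ennreal (g x / f x) = RN_deriv (density M f) (density M g) x"
    using f by (subst (asm) AE_density) auto
  with ac have "AE x in M. 0 < g x \<longrightarrow> ennreal (g x / f x) = RN_deriv (density M f) (density M g) x"
  proof eventually_elim
    case (elim x)
    then show ?case using f(2)[of x] by (auto simp: less_le)
  qed
  then have "AE x in density M g. ennreal (g x / f x) = RN_deriv (density M f) (density M g) x"
    using g by (subst AE_density) auto
  then show ?thesis
  proof eventually_elim
    case (elim x)
    then show ?case
      using f(2)[of x] g(2)[of x] by (simp add: entropy_density_def flip: elim)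
  qed
qed

text \<open>Without absolute continuity \<open>RN_deriv\<close> is \<open>0\<close>, and so is \<open>log b 0\<close>.\<close>

lemma (in sigma_finite_measure) KL_divergence_not_ac:
  fixes f g :: "'a \<Rightarrow> real"
  assumes f: "f \<in> borel_measurable M" "\<And>x. 0 \<le> f x"
    and g: "g \<in> borel_measurable M" "\<And>x. 0 \<le> g x"
    and nac: "\<not> (AE x in M. f x = 0 \<longrightarrow> g x = 0)"
  shows "KL_divergence b (density M f) (density M g) = 0"
proof -
  have "\<not> (\<exists>h. h \<in> borel_measurable (density M f) \<and> density (density M f) h = density M g)"
  proof
    assume "\<exists>h. h \<in> borel_measurable (density M f) \<and> density (density M f) h = density M g"
    then obtain h where h: "h \<in> borel_measurable (density M f)" "density (density M f) h = density M g"
      by blast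
    have "absolutely_continuous (density M f) (density M g)"
      using absolutely_continuousI_density[OF h(1)] h(2) by simp
    moreover have "AE x in density M f. f x \<noteq> 0"
      using f by (subst AE_density) auto
    ultimately have "AE x in density M g. f x \<noteq> 0"
      by (intro absolutely_continuous_AE[of "density M g" "density M f"]) auto
    then have "AE x in M. 0 < g x \<longrightarrow> f x \<noteq> 0"
      using g by (subst (asm) AE_density) auto
    then have "AE x in M. f x = 0 \<longrightarrow> g x = 0"
    proof eventually_elim
      case (elim x)
      then show ?case using g(2)[of x] by (auto simp: less_le)
    qed
    with nac show False ..
  qed
  then have "RN_deriv (density M f) (density M g) = (\<lambda>_. 0)"
    unfolding RN_deriv_def by (rule if_not_P)
  then show ?thesis
    by (simp add: KL_divergence_def entropy_density_def comp_def log_def)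
qed

text \<open>Absolute continuity may hold for some \<open>x\<close> and fail for others. The
  parameters where it holds form the zero set of the integral of \<open>?bad\<close>, hence a
  measurable set; on it the divergence is an integral depending measurably on \<open>x\<close>, and
  off it the value is 0.\<close>

lemma (in sigma_finite_measure) borel_measurable_KL_divergence_density:
  fixes f g :: "'b \<Rightarrow> 'a \<Rightarrow> real"
  assumes [measurable]: "case_prod f \<in> borel_measurable (N \<Otimes>\<^sub>M M)" "case_prod g \<in> borel_measurable (N \<Otimes>\<^sub>M M)"
    and nn: "\<And>x y. 0 \<le> f x y" "\<And>x y. 0 \<le> g x y" and b: "1 < b"
  shows "(\<lambda>x. KL_divergence b (density M (f x)) (density M (g x))) \<in> borel_measurable N"
proof -
  let ?bad = "\<lambda>x y. if f x y = 0 \<and> g x y \<noteq> 0 then 1 else 0 :: ennreal"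
  have "KL_divergence b (density M (f x)) (density M (g x)) =
    (if (\<integral>\<^sup>+y. ?bad x y \<partial>M) = 0 then (\<integral>y. g x y * log b (g x y / f x y) \<partial>M) else 0)"
    if x: "x \<in> space N" for x
  proof -
    have [measurable]: "f x \<in> borel_measurable M" "g x \<in> borel_measurable M"
      using x by measurable
    have "(\<integral>\<^sup>+y. ?bad x y \<partial>M) = 0 \<longleftrightarrow> (AE y in M. ?bad x y = 0)"
      by (intro nn_integral_0_iff_AE) measurable
    also have "\<dots> \<longleftrightarrow> (AE y in M. f x y = 0 \<longrightarrow> g x y = 0)"
      by (intro AE_cong) auto
    finally have iff: "(\<integral>\<^sup>+y. ?bad x y \<partial>M) = 0 \<longleftrightarrow> (AE y in M. f x y = 0 \<longrightarrow> g x y = 0)" .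
    show ?thesis
      unfolding iff using b nn by (auto simp: KL_density_density KL_divergence_not_ac)
  qed
  then show ?thesis
    by (subst measurable_cong) (assumption, measurable)
qed

lemma ln_gaussian_density_divide:
  assumes "pos_def \<Sigma>\<^sub>1" "pos_def \<Sigma>\<^sub>2"
  shows "ln (gaussian_density m\<^sub>1 \<Sigma>\<^sub>1 z / gaussian_density m\<^sub>2 \<Sigma>\<^sub>2 z) =
    (1 / 2) * ln (det \<Sigma>\<^sub>2 / det \<Sigma>\<^sub>1) + (1 / 2) * ((z - m\<^sub>2) \<bullet> (matrix_inv \<Sigma>\<^sub>2 *v (z - m\<^sub>2)))
      - (1 / 2) * ((z - m\<^sub>1) \<bullet> (matrix_inv \<Sigma>\<^sub>1 *v (z - m\<^sub>1)))"
proof -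
  have d: "det \<Sigma>\<^sub>1 > 0" "det \<Sigma>\<^sub>2 > 0"
    using assms by (auto intro: pos_def_det_pos)
  have p: "(2 * pi) ^ k > 0" for k
    by simp
  show ?thesis
    using d unfolding gaussian_density_def
    by (simp add: ln_div ln_sqrt ln_mult p field_simps)
qed

text \<open>The quadratic form of the second Gaussian averages to the trace and the mean term, that
  of the first to the trace of the identity, which is the source of the dimension term.
  Integrability is part of the statement because the theorem also claims convergence.\<close>

lemma gaussian_entropy_density:
  fixes m\<^sub>1 m\<^sub>2 :: "real ^ 'n"
  assumes "pos_def \<Sigma>\<^sub>1" "pos_def \<Sigma>\<^sub>2"
  shows "has_bochner_integral (gaussian m\<^sub>1 \<Sigma>\<^sub>1)
    (entropy_density (exp 1) (gaussian m\<^sub>2 \<Sigma>\<^sub>2) (gaussian m\<^sub>1 \<Sigma>\<^sub>1))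
    ((trace (matrix_inv \<Sigma>\<^sub>2 ** \<Sigma>\<^sub>1) - real CARD('n) + ln (det \<Sigma>\<^sub>2 / det \<Sigma>\<^sub>1)
      + (m\<^sub>1 - m\<^sub>2) \<bullet> (matrix_inv \<Sigma>\<^sub>2 *v (m\<^sub>1 - m\<^sub>2))) / 2)"
proof -
  interpret prob_space "gaussian m\<^sub>1 \<Sigma>\<^sub>1"
    using assms(1) by (rule prob_space_gaussian)
  let ?c = "ln (det \<Sigma>\<^sub>2 / det \<Sigma>\<^sub>1)" and ?v = "m\<^sub>1 - m\<^sub>2"
  have "matrix_inv \<Sigma>\<^sub>1 ** \<Sigma>\<^sub>1 = mat 1"
    using assms(1) by (simp add: matrix_inv_left pos_def_invertible)
  then have tr: "trace (matrix_inv \<Sigma>\<^sub>1 ** \<Sigma>\<^sub>1) = real CARD('n)"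
    by (simp add: trace_I)
  have c: "has_bochner_integral (gaussian m\<^sub>1 \<Sigma>\<^sub>1) (\<lambda>_. 1 / 2 * ?c) (1 / 2 * ?c)"
    using prob_space by (simp add: has_bochner_integral_iff)
  have "has_bochner_integral (gaussian m\<^sub>1 \<Sigma>\<^sub>1)
      (\<lambda>z. (1 / 2) * ?c + (1 / 2) * ((z - m\<^sub>2) \<bullet> (matrix_inv \<Sigma>\<^sub>2 *v (z - m\<^sub>2)))
        - (1 / 2) * ((z - m\<^sub>1) \<bullet> (matrix_inv \<Sigma>\<^sub>1 *v (z - m\<^sub>1))))
      ((1 / 2) * ?c + (1 / 2) * (trace (matrix_inv \<Sigma>\<^sub>2 ** \<Sigma>\<^sub>1) + ?v \<bullet> (matrix_inv \<Sigma>\<^sub>2 *v ?v))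
        - (1 / 2) * (trace (matrix_inv \<Sigma>\<^sub>1 ** \<Sigma>\<^sub>1) + (m\<^sub>1 - m\<^sub>1) \<bullet> (matrix_inv \<Sigma>\<^sub>1 *v (m\<^sub>1 - m\<^sub>1))))"
    (is "has_bochner_integral _ _ ?I")
    by (intro has_bochner_integral_add has_bochner_integral_diff has_bochner_integral_mult_right c
        gaussian_quadratic assms)
  moreover have "?I = (trace (matrix_inv \<Sigma>\<^sub>2 ** \<Sigma>\<^sub>1) - real CARD('n) + ?c + ?v \<bullet> (matrix_inv \<Sigma>\<^sub>2 *v ?v)) / 2"
    by (simp add: tr field_simps)
  moreover have "(\<lambda>z. (1 / 2) * ?c + (1 / 2) * ((z - m\<^sub>2) \<bullet> (matrix_inv \<Sigma>\<^sub>2 *v (z - m\<^sub>2)))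
        - (1 / 2) * ((z - m\<^sub>1) \<bullet> (matrix_inv \<Sigma>\<^sub>1 *v (z - m\<^sub>1))))
      = (\<lambda>z. log (exp 1) (gaussian_density m\<^sub>1 \<Sigma>\<^sub>1 z / gaussian_density m\<^sub>2 \<Sigma>\<^sub>2 z))"
    unfolding ln_gaussian_density_divide[OF assms, symmetric] by (simp add: log_def)
  ultimately have I: "has_bochner_integral (gaussian m\<^sub>1 \<Sigma>\<^sub>1)
      (\<lambda>z. log (exp 1) (gaussian_density m\<^sub>1 \<Sigma>\<^sub>1 z / gaussian_density m\<^sub>2 \<Sigma>\<^sub>2 z))
      ((trace (matrix_inv \<Sigma>\<^sub>2 ** \<Sigma>\<^sub>1) - real CARD('n) + ?c + ?v \<bullet> (matrix_inv \<Sigma>\<^sub>2 *v ?v)) / 2)"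
    by (simp only:)
  have pos: "gaussian_density m\<^sub>1 \<Sigma>\<^sub>1 z > 0" "gaussian_density m\<^sub>2 \<Sigma>\<^sub>2 z > 0" for z
    using assms by (auto intro: gaussian_density_pos)
  have "AE z in gaussian m\<^sub>1 \<Sigma>\<^sub>1. entropy_density (exp 1) (gaussian m\<^sub>2 \<Sigma>\<^sub>2) (gaussian m\<^sub>1 \<Sigma>\<^sub>1) z
    = log (exp 1) (gaussian_density m\<^sub>1 \<Sigma>\<^sub>1 z / gaussian_density m\<^sub>2 \<Sigma>\<^sub>2 z)"
    unfolding gaussian_def using pos
    by (intro lborel.entropy_density_density_density) (auto simp: less_imp_le less_imp_neq[THEN not_sym])
  moreover have "entropy_density (exp 1) (gaussian m\<^sub>2 \<Sigma>\<^sub>2) (gaussian m\<^sub>1 \<Sigma>\<^sub>1) \<in> borel_measurable (gaussian m\<^sub>1 \<Sigma>\<^sub>1)"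
    using measurable_entropy_density[of "exp 1" "gaussian m\<^sub>2 \<Sigma>\<^sub>2" "gaussian m\<^sub>1 \<Sigma>\<^sub>1"]
    by (simp cong: measurable_cong_sets)
  ultimately show ?thesis
    using I by (subst has_bochner_integral_cong_AE) (auto simp: has_bochner_integral_iff)
qed

lemma relative_entropy_gaussian:
  fixes m\<^sub>1 m\<^sub>2 :: "real ^ 'n"
  assumes "pos_def \<Sigma>\<^sub>1" "pos_def \<Sigma>\<^sub>2"
  shows "relative_entropy (gaussian m\<^sub>1 \<Sigma>\<^sub>1) (gaussian m\<^sub>2 \<Sigma>\<^sub>2) =
    (trace (matrix_inv \<Sigma>\<^sub>2 ** \<Sigma>\<^sub>1) - real CARD('n) + ln (det \<Sigma>\<^sub>2 / det \<Sigma>\<^sub>1)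
      + (m\<^sub>1 - m\<^sub>2) \<bullet> (matrix_inv \<Sigma>\<^sub>2 *v (m\<^sub>1 - m\<^sub>2))) / 2"
  unfolding relative_entropy_def KL_divergence_def
  using gaussian_entropy_density[OF assms] by (rule has_bochner_integral_integral_eq)

section \<open>Conditioning a Gaussian on a block of coordinates\<close>

lemma sum_UNIV_Plus:
  fixes f :: "'p::finite + 'g::finite \<Rightarrow> 'a::comm_monoid_add"
  shows "(\<Sum>i\<in>UNIV. f i) = (\<Sum>a\<in>UNIV. f (Inl a)) + (\<Sum>b\<in>UNIV. f (Inr b))"
  unfolding UNIV_Plus_UNIV[symmetric] by (subst sum.Plus) auto

lemma prod_UNIV_Plus:
  fixes f :: "'p::finite + 'g::finite \<Rightarrow> 'a::comm_monoid_mult"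
  shows "(\<Prod>i\<in>UNIV. f i) = (\<Prod>a\<in>UNIV. f (Inl a)) * (\<Prod>b\<in>UNIV. f (Inr b))"
  unfolding UNIV_Plus_UNIV[symmetric] by (subst prod.Plus) auto

lemma block_vec_nth [simp]:
  "block_vec x y $ Inl a = x $ a" "block_vec x y $ Inr b = y $ b"
  by (simp_all add: block_vec_def)

lemma block_vec_eqI:
  assumes "\<And>a. u $ Inl a = v $ Inl a" "\<And>b. u $ Inr b = v $ Inr b"
  shows "u = v"
  using assms by (auto simp: vec_eq_iff split: sum.splits) (metis sum.exhaust)

lemma block_vec_eq_iff [simp]: "block_vec x y = block_vec x' y' \<longleftrightarrow> x = x' \<and> y = y'"
  by (metis block_vec_nth vec_eq_iff)

lemma block_vec_diff: "block_vec x y - block_vec x' y' = block_vec (x - x') (y - y')"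
  by (intro block_vec_eqI) auto

lemma block_vec_zero: "block_vec 0 0 = 0"
  by (intro block_vec_eqI) auto

lemma inner_block_vec: "block_vec x y \<bullet> block_vec x' y' = x \<bullet> x' + y \<bullet> y'"
  by (simp add: inner_vec_def sum_UNIV_Plus)

lemma block_mat_nth [simp]:
  "block_mat A B C D $ Inl a = block_vec (A $ a) (B $ a)"
  "block_mat A B C D $ Inr b = block_vec (C $ b) (D $ b)"
  by (simp_all add: block_mat_def)

lemma block_mat_mult_block_vec:
  "block_mat A B C D *v block_vec x y = block_vec (A *v x + B *v y) (C *v x + D *v y)"
  by (intro block_vec_eqI) (simp_all add: matrix_vector_mult_def sum_UNIV_Plus)

lemma transpose_block_mat:
  "transpose (block_mat A B C D) = block_mat (transpose A) (transpose C) (transpose B) (transpose D)"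
  by (intro block_vec_eqI) (simp_all add: transpose_def)

lemma block_mat_eq_iff [simp]:
  "block_mat A B C D = block_mat A' B' C' D' \<longleftrightarrow> A = A' \<and> B = B' \<and> C = C' \<and> D = D'"
  by (metis block_mat_nth block_vec_eq_iff vec_eq_iff)

lemma pos_def_block_mat_A:
  assumes "pos_def (block_mat A B C D)"
  shows "pos_def A"
proof -
  have "x \<bullet> (A *v x) > 0" if "x \<noteq> 0" for x
  proof -
    have "block_vec x 0 \<noteq> 0"
      using that by (metis block_vec_eq_iff block_vec_zero)
    then have "block_vec x 0 \<bullet> (block_mat A B C D *v block_vec x 0) > 0"
      using assms unfolding pos_def_def by blast
    then show ?thesis
      by (simp add: block_mat_mult_block_vec inner_block_vec)
  qed
  then show ?thesis
    using assms by (simp add: pos_def_def transpose_block_mat)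
qed

lemma transpose_minus: "transpose (A - B) = transpose A - transpose B"
  by (simp add: transpose_def vec_eq_iff)

lemma continuous_on_block_vec [continuous_intros]:
  assumes "continuous_on T f" "continuous_on T g"
  shows "continuous_on T (\<lambda>z. block_vec (f z) (g z))"
  unfolding block_vec_def
proof (rule continuous_on_vec_lambda)
  show "continuous_on T (\<lambda>z. case i of Inl a \<Rightarrow> f z $ a | Inr b \<Rightarrow> g z $ b)" for i
    using assms by (cases i) (auto intro: continuous_intros)
qed

lemma borel_measurable_block_vec [measurable (raw)]:
  assumes "f \<in> borel_measurable M" "g \<in> borel_measurable M"
  shows "(\<lambda>z. block_vec (f z) (g z)) \<in> borel_measurable M"
  using assms by (rule borel_measurable_continuous_Pair)
    (auto intro!: continuous_intros)

context
  fixes A :: "real ^ 'p ^ 'p" and B :: "real ^ 'g ^ 'p" and C :: "real ^ 'g ^ 'g"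
    and R :: "real ^ 'p ^ 'g" and S :: "real ^ 'g ^ 'g"
  assumes pd: "pos_def (block_mat A B (transpose B) C)"
  assumes R_def: "R = transpose B ** matrix_inv A"
  assumes S_def: "S = C - transpose B ** matrix_inv A ** B"
begin

private lemma A: "pos_def A"
  using pd by (rule pos_def_block_mat_A)

private lemma transposes: "transpose A = A" "transpose C = C" "transpose (matrix_inv A) = matrix_inv A"
  using pd A matrix_inv_pos_def[OF A] by (simp_all add: pos_def_def transpose_block_mat)

private lemma A_inv: "A *v (matrix_inv A *v x) = x"
  by (simp add: matrix_vector_mul_assoc matrix_inv_right pos_def_invertible[OF A])

text \<open>Block elimination: the first component is chosen to make the first block equal
  \<open>x\<close>. This replaces a formula for the inverse block matrix: with \<open>x = 0\<close>
  it exposes the Schur complement, and with \<open>S *v v = y - R *v x\<close> it solves the linear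
  system with right-hand side \<open>block_vec x y\<close>.\<close>

private lemma block_mat_mult:
  "block_mat A B (transpose B) C *v block_vec (matrix_inv A *v (x - B *v v)) v = block_vec x (R *v x + S *v v)"
proof -
  have "transpose B *v (matrix_inv A *v (x - B *v v)) + C *v v = R *v x + S *v v"
    unfolding R_def S_def
    by (simp only: matrix_vector_mult_diff_distrib matrix_vector_mult_diff_rdistrib
        matrix_vector_mul_assoc[symmetric]) simp
  then show ?thesis
    by (simp add: block_mat_mult_block_vec A_inv)
qed

lemma pos_def_Schur_complement: "pos_def S"
proof -
  have "transpose S = S"
    by (simp add: S_def transpose_minus matrix_transpose_mul transposes matrix_mul_assoc)
  moreover have "v \<bullet> (S *v v) > 0" if "v \<noteq> 0" for v
  proof -
    \<comment> \<open>The first component is chosen so that the first block of the product vanishes,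
      which leaves \<open>v \<bullet> (S *v v)\<close> as the quadratic form.\<close>
    let ?u = "block_vec (matrix_inv A *v (0 - B *v v)) v"
    have "?u \<noteq> 0"
      using that by (metis block_vec_eq_iff block_vec_zero)
    then have "?u \<bullet> (block_mat A B (transpose B) C *v ?u) > 0"
      using pd unfolding pos_def_def by blast
    then show ?thesis
      unfolding block_mat_mult by (simp add: inner_block_vec)
  qed
  ultimately show ?thesis
    by (simp add: pos_def_def)
qed

text \<open>Completing the square around the conditional mean \<open>R *v x\<close>. The inverse is
  never computed, only applied to one vector by exhibiting the solution \<open>u\<close>.\<close>

private lemma quadratic_form_block:
  "block_vec x y \<bullet> (matrix_inv (block_mat A B (transpose B) C) *v block_vec x y) =
    x \<bullet> (matrix_inv A *v x) + (y - R *v x) \<bullet> (matrix_inv S *v (y - R *v x))"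
proof -
  let ?\<Sigma> = "block_mat A B (transpose B) C"
  define v where "v = matrix_inv S *v (y - R *v x)"
  define u where "u = block_vec (matrix_inv A *v (x - B *v v)) v"
  have "S *v v = y - R *v x"
    by (simp add: v_def matrix_vector_mul_assoc matrix_inv_right
        pos_def_invertible[OF pos_def_Schur_complement])
  then have "?\<Sigma> *v u = block_vec x y"
    unfolding u_def block_mat_mult by simp
  then have "matrix_inv ?\<Sigma> *v block_vec x y = matrix_inv ?\<Sigma> *v (?\<Sigma> *v u)"
    by simp
  also have "\<dots> = u"
    by (simp add: matrix_vector_mul_assoc matrix_inv_left pos_def_invertible[OF pd])
  finally have "block_vec x y \<bullet> (matrix_inv ?\<Sigma> *v block_vec x y) = x \<bullet> (matrix_inv A *v (x - B *v v)) + y \<bullet> v"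
    by (simp add: u_def inner_block_vec)
  also have "x \<bullet> (matrix_inv A *v (x - B *v v)) = x \<bullet> (matrix_inv A *v x) - (R *v x) \<bullet> v"
  proof -
    have "x \<bullet> (matrix_inv A *v (B *v v)) = (R *v x) \<bullet> v"
      unfolding R_def transpose_mat_vec_dot
      by (simp only: matrix_transpose_mul transposes transpose_transpose matrix_vector_mul_assoc)
    then show ?thesis
      by (simp add: matrix_vector_mult_diff_distrib inner_diff_right)
  qed
  finally show ?thesis
    by (simp add: v_def inner_diff_left)
qed

text \<open>A box in the joint space is a product of boxes, which suffices to identify Lebesgue
  measure; joint densities can then be integrated block by block.\<close>

private lemma lborel_block_vec:
  "lborel = distr (lborel \<Otimes>\<^sub>M lborel) borel (\<lambda>(x :: real ^ 'p, y :: real ^ 'g). block_vec x y)"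
proof (rule lborel_eqI)
  let ?f = "\<lambda>(x :: real ^ 'p, y :: real ^ 'g). block_vec x y"
  fix l u :: "real ^ ('p + 'g)"
  assume le: "\<And>b. b \<in> Basis \<Longrightarrow> l \<bullet> b \<le> u \<bullet> b"
  have le': "l $ i \<le> u $ i" for i
    using le[of "axis i 1"] by (simp add: inner_axis)
  define lp where "lp = (\<chi> a. l $ Inl a)"
  define lg where "lg = (\<chi> b. l $ Inr b)"
  define up where "up = (\<chi> a. u $ Inl a)"
  define ug where "ug = (\<chi> b. u $ Inr b)"
  have vol: "emeasure lborel (box v w) = ennreal (\<Prod>i\<in>UNIV. w $ i - v $ i)"
    if "\<And>i. v $ i \<le> w $ i" for v w :: "real ^ 'k"
    using that by (subst emeasure_lborel_box)
      (auto simp: Basis_vec_def inner_axis axis_eq_axis prod.UNION_disjoint)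
  have P: "(\<Prod>b\<in>Basis. (u - l) \<bullet> b) = (\<Prod>i\<in>UNIV. u $ i - l $ i)"
    by (simp add: Basis_vec_def axis_eq_axis prod.UNION_disjoint inner_axis)
  have "?f -` box l u = box lp up \<times> box lg ug"
    by (auto simp: mem_box_cart lp_def lg_def up_def ug_def)
       (metis block_vec_nth sum.exhaust)+
  then have "emeasure (distr (lborel \<Otimes>\<^sub>M lborel) borel ?f) (box l u)
    = emeasure (lborel \<Otimes>\<^sub>M lborel) (box lp up \<times> box lg ug)"
    by (subst emeasure_distr) (auto simp: space_pair_measure)
  also have "\<dots> = ennreal (\<Prod>a\<in>UNIV. u $ Inl a - l $ Inl a) * ennreal (\<Prod>b\<in>UNIV. u $ Inr b - l $ Inr b)"
    by (subst lborel.emeasure_pair_measure_Times) (auto simp: vol le' lp_def lg_def up_def ug_def)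
  also have "\<dots> = ennreal (\<Prod>b\<in>Basis. (u - l) \<bullet> b)"
    unfolding P by (simp add: prod_UNIV_Plus ennreal_mult prod_nonneg le')
  finally show "emeasure (distr (lborel \<Otimes>\<^sub>M lborel) borel ?f) (box l u) = ennreal (\<Prod>b\<in>Basis. (u - l) \<bullet> b)" .
qed simp

text \<open>The quadratic forms agree, so the two sides differ by a constant factor; as both are probability
  densities, it is 1. This avoids computing the determinant of a block matrix.\<close>

lemma gaussian_density_block:
  "gaussian_density (block_vec mp mg) (block_mat A B (transpose B) C) (block_vec x y) =
    gaussian_density mp A x * gaussian_density (mg + R *v (x - mp)) S y"
proof -
  let ?\<Sigma> = "block_mat A B (transpose B) C" and ?m = "block_vec mp mg"
  define a where "a = sqrt ((2 * pi) ^ CARD('p) * det A)"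
  define s where "s = sqrt ((2 * pi) ^ CARD('g) * det S)"
  define t where "t = sqrt ((2 * pi) ^ CARD('p + 'g) * det ?\<Sigma>)"
  define c where "c = a * s / t"
  have pos: "a > 0" "s > 0" "t > 0"
    using A pos_def_Schur_complement pd by (simp_all add: a_def s_def t_def pos_def_det_pos)
  then have "c > 0"
    by (simp add: c_def)
  have eq: "gaussian_density ?m ?\<Sigma> (block_vec x y) =
    c * (gaussian_density mp A x * gaussian_density (mg + R *v (x - mp)) S y)" for x y
  proof -
    have "y - mg - R *v (x - mp) = y - (mg + R *v (x - mp))"
      by simp
    then show ?thesis
      unfolding gaussian_density_def block_vec_diff quadratic_form_block a_def[symmetric] s_def[symmetric] t_def[symmetric]
      using pos by (simp add: c_def add_divide_distrib exp_add[symmetric] diff_diff_eq)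
  qed
  have one: "(\<integral>\<^sup>+z. ennreal (gaussian_density m V z) \<partial>lborel) = 1" if "pos_def V" for m and V :: "real ^ 'k ^ 'k"
  proof -
    interpret prob_space "gaussian m V"
      using that by (rule prob_space_gaussian)
    show ?thesis
      using emeasure_space_1 by (simp add: gaussian_def emeasure_density)
  qed
  have nn: "gaussian_density m V z \<ge> 0" if "pos_def V" for m z and V :: "real ^ 'k ^ 'k"
    using gaussian_density_pos[OF that] by (rule less_imp_le)
  have "1 = (\<integral>\<^sup>+z. ennreal (gaussian_density ?m ?\<Sigma> z) \<partial>distr (lborel \<Otimes>\<^sub>M lborel) borel (\<lambda>(x, y). block_vec x y))"
    using one[OF pd] unfolding lborel_block_vec ..
  also have "\<dots> = (\<integral>\<^sup>+z. ennreal (gaussian_density ?m ?\<Sigma> (block_vec (fst z) (snd z))) \<partial>(lborel \<Otimes>\<^sub>M lborel))"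
    by (subst nn_integral_distr) (auto simp: case_prod_unfold)
  also have "\<dots> = (\<integral>\<^sup>+x. \<integral>\<^sup>+y. ennreal (gaussian_density ?m ?\<Sigma> (block_vec x y)) \<partial>lborel \<partial>lborel)"
    by (subst lborel.nn_integral_fst[symmetric]) auto
  also have "\<dots> = (\<integral>\<^sup>+x. ennreal c * (ennreal (gaussian_density mp A x)
      * (\<integral>\<^sup>+y. ennreal (gaussian_density (mg + R *v (x - mp)) S y) \<partial>lborel)) \<partial>lborel)"
    using \<open>c > 0\<close> A pos_def_Schur_complement
    by (simp add: eq ennreal_mult nn nn_integral_cmult)
  \<comment> \<open>The mean of the second factor moves with \<open>x\<close> but its mass does not,
    so the inner integral is 1 for every \<open>x\<close>.\<close>
  also have "\<dots> = ennreal c"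
    using A pos_def_Schur_complement by (simp add: one nn_integral_cmult)
  finally have "c = 1"
    using \<open>c > 0\<close> by (metis ennreal_1 ennreal_inj less_imp_le zero_le_one)
  then show ?thesis
    using eq by simp
qed

end

section \<open>Tetrahedra in barycentric coordinates\<close>

lemma smooth_on_continuous_on:
  assumes "smooth_on S f"
  shows "continuous_on S f"
  using assms unfolding smooth_on_def by (metis Ck_on.simps(1))

lemma smooth_on_differentiable:
  assumes "smooth_on S f" "x \<in> S"
  shows "f differentiable (at x)"
  using assms unfolding smooth_on_def by (metis Ck_on.simps(2))

lemma smooth_on_continuous_on_derivative:
  assumes "smooth_on S f"
  shows "continuous_on S (\<lambda>x. frechet_derivative f (at x) v)"
proof -
  have "Ck_on (Suc 0) f S"
    using assms unfolding smooth_on_def by blast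
  then show ?thesis by simp
qed

lemma continuous_on_matrix_matrix_mult:
  fixes A :: "'a::topological_space \<Rightarrow> real ^ 'n ^ 'm" and B :: "'a \<Rightarrow> real ^ 'k ^ 'n"
  assumes "continuous_on S A" "continuous_on S B"
  shows "continuous_on S (\<lambda>x. A x ** B x)"
  unfolding matrix_matrix_mult_def
  by (intro continuous_on_vec_lambda continuous_intros assms)

lemma continuous_on_matrix_transpose:
  fixes A :: "'a::topological_space \<Rightarrow> real ^ 'n ^ 'm"
  assumes "continuous_on S A"
  shows "continuous_on S (\<lambda>x. transpose (A x))"
  unfolding transpose_def
  by (intro continuous_on_vec_lambda continuous_intros assms)

lemma continuous_on_matrix_det:
  fixes A :: "'a::topological_space \<Rightarrow> real ^ 'n ^ 'n"
  assumes "continuous_on S A"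
  shows "continuous_on S (\<lambda>x. det (A x))"
  unfolding det_def by (intro continuous_intros assms)

text \<open>Cramer's rule applied to the columns of the inverse. Written as quotients of
  determinants, the entries are visibly continuous in the matrix.\<close>

lemma matrix_inv_cofactor:
  fixes A :: "real ^ 'n ^ 'n"
  assumes "det A \<noteq> 0"
  shows "matrix_inv A $ k $ j = det (\<chi> i l. if l = k then axis j 1 $ i else A $ i $ l) / det A"
proof -
  let ?x = "matrix_inv A *v axis j 1"
  have "A *v ?x = axis j 1"
    using assms by (simp add: matrix_vector_mul_assoc matrix_inv_right invertible_det_nz)
  then have "?x = (\<chi> k. det (\<chi> i l. if l = k then axis j 1 $ i else A $ i $ l) / det A)"
    using cramer[OF assms] by blast
  then have "?x $ k = det (\<chi> i l. if l = k then axis j 1 $ i else A $ i $ l) / det A"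
    by simp
  moreover have "?x $ k = matrix_inv A $ k $ j"
    by (simp add: matrix_vector_mult_basis column_def)
  ultimately show ?thesis by simp
qed

lemma continuous_on_matrix_inv_nth:
  fixes A :: "'a::topological_space \<Rightarrow> real ^ 'n ^ 'n"
  assumes "continuous_on S A" "\<And>x. x \<in> S \<Longrightarrow> det (A x) \<noteq> 0"
  shows "continuous_on S (\<lambda>x. matrix_inv (A x) $ k $ j)"
proof -
  have "continuous_on S (\<lambda>x. det (\<chi> i l. if l = k then axis j 1 $ i else A x $ i $ l))"
  proof (intro continuous_on_matrix_det continuous_on_vec_lambda)
    show "continuous_on S (\<lambda>x. if l = k then axis j 1 $ i else A x $ i $ l)" for i l
      by (cases "l = k") (auto intro!: continuous_intros assms)
  qed
  then have "continuous_on S (\<lambda>x. det (\<chi> i l. if l = k then axis j 1 $ i else A x $ i $ l) / det (A x))"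
    by (rule continuous_on_divide[OF _ continuous_on_matrix_det[OF assms(1)]]) (use assms(2) in blast)
  then show ?thesis
    by (rule continuous_on_cong[THEN iffD1, rotated 2]) (simp_all add: matrix_inv_cofactor assms)
qed

lemma pos_def_congruence:
  fixes A :: "real ^ 'n ^ 'n" and J :: "real ^ 'm ^ 'n"
  assumes "pos_def A" and "\<And>x. x \<noteq> 0 \<Longrightarrow> J *v x \<noteq> 0"
  shows "pos_def (transpose J ** A ** J)"
proof -
  have "x \<bullet> ((transpose J ** A ** J) *v x) > 0" if "x \<noteq> 0" for x
  proof -
    have "x \<bullet> ((transpose J ** A ** J) *v x) = (J *v x) \<bullet> (A *v (J *v x))"
      unfolding transpose_mat_vec_dot by (simp only: matrix_vector_mul_assoc matrix_mul_assoc)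
    then show ?thesis
      using assms that by (simp add: pos_def_def)
  qed
  then show ?thesis
    using assms(1) by (simp add: pos_def_def matrix_transpose_mul matrix_mul_assoc)
qed

text \<open>Near each point of \<open>K\<close>, also on the boundary of \<open>R\<close>,
  \<open>f\<close> coincides on \<open>R\<close> with a continuous function and so is bounded there;
  compactness makes the bound uniform, and \<open>R\<close> has finite measure. The extensions
  \<open>h\<close> are only local because in the application each comes from a single chart.\<close>

lemma set_integrable_locally_continuous:
  fixes f :: "'a::euclidean_space \<Rightarrow> real"
  assumes K: "compact K" and R: "R \<subseteq> K" "open R"
    and loc: "\<And>s. s \<in> K \<Longrightarrow> \<exists>U h. open U \<and> s \<in> U \<and> continuous_on U h \<and> (\<forall>x\<in>U \<inter> R. f x = h x)"
  shows "set_integrable lborel R f"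
proof -
  define \<C> where "\<C> = {V. open V \<and> continuous_on (V \<inter> R) f \<and> bounded (f ` (V \<inter> R))}"
  have "s \<in> \<Union>\<C>" if s: "s \<in> K" for s
  proof -
    obtain U h where U: "open U" "s \<in> U" "continuous_on U h" "\<And>x. x \<in> U \<inter> R \<Longrightarrow> f x = h x"
      using loc[OF s] by blast
    \<comment> \<open>Shrinking \<open>U\<close> to where \<open>h\<close> stays within 1 of
      \<open>h s\<close> provides the local bound.\<close>
    define V where "V = U \<inter> h -` ball (h s) 1"
    have "open V"
      unfolding V_def using U by (intro continuous_open_preimage) auto
    moreover have "continuous_on (V \<inter> R) f"
    proof (rule continuous_on_eq)
      show "continuous_on (V \<inter> R) h"
        using U(3) by (rule continuous_on_subset) (auto simp: V_def)
      show "h x = f x" if "x \<in> V \<inter> R" for x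
        using U(4)[of x] that by (simp add: V_def)
    qed
    moreover have "f ` (V \<inter> R) \<subseteq> ball (h s) 1"
      using U(4) by (auto simp: V_def)
    then have "bounded (f ` (V \<inter> R))"
      using bounded_ball bounded_subset by blast
    ultimately have "V \<in> \<C>"
      by (simp add: \<C>_def)
    moreover have "s \<in> V"
      using U by (simp add: V_def)
    ultimately show ?thesis by blast
  qed
  then have "K \<subseteq> \<Union>\<C>" by blast
  moreover have "open V" if "V \<in> \<C>" for V
    using that by (simp add: \<C>_def)
  ultimately obtain D where D: "D \<subseteq> \<C>" "finite D" "K \<subseteq> \<Union>D"
    using compactE[OF K, of \<C>] by metis
  have DR: "(\<Union>V\<in>D. V \<inter> R) = R"
    using D R by blast
  have "continuous_on (\<Union>V\<in>D. V \<inter> R) f"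
    using D R by (intro continuous_on_open_UN) (auto simp: \<C>_def)
  then have cont: "continuous_on R f"
    by (simp only: DR)
  have "bounded (\<Union>V\<in>D. f ` (V \<inter> R))"
    using D by (intro bounded_UN) (auto simp: \<C>_def)
  then have "bounded (f ` R)"
    by (simp only: image_UN[symmetric] DR)
  then obtain B where bound: "\<And>x. x \<in> R \<Longrightarrow> norm (f x) \<le> B"
    by (auto simp: bounded_iff)
  have fin: "emeasure lborel R < \<infinity>"
    using K R by (meson bounded_subset compact_imp_bounded emeasure_bounded_finite)
  \<comment> \<open>\<open>f\<close> is controlled only on \<open>R\<close>: the inner indicator
    makes the integrand measurable on the whole space, and the outer one is required by the rule and
    changes nothing.\<close>
  have "integrable lborel (\<lambda>x. indicator R x *\<^sub>R (indicator R x *\<^sub>R f x))"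
  proof (rule integrableI_bounded_set_indicator[OF _ _ fin])
    show "(\<lambda>x. indicator R x *\<^sub>R f x) \<in> borel_measurable lborel"
      using borel_measurable_continuous_on_indicator[OF _ cont] R by simp
    show "AE x\<in>R in lborel. norm (indicator R x *\<^sub>R f x) \<le> B"
      using bound by auto
  qed (use R in simp)
  moreover have "(\<lambda>x. indicator R x *\<^sub>R (indicator R x *\<^sub>R f x)) = (\<lambda>x. indicat_real R x *\<^sub>R f x)"
    by (auto simp: indicator_def)
  ultimately show ?thesis
    by (simp only: set_integrable_def)
qed

section \<open>The closed reference tetrahedron and its barycentric parametrization\<close>

definition closed_ref_simplex :: "(real ^ 3) set" where
  "closed_ref_simplex = {s. 0 \<le> s $ 1 \<and> 0 \<le> s $ 2 \<and> 0 \<le> s $ 3 \<and> s $ 1 + s $ 2 + s $ 3 \<le> 1}"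

lemma compact_closed_ref_simplex: "compact closed_ref_simplex"
proof -
  have "closed closed_ref_simplex"
    unfolding closed_ref_simplex_def
    by (intro closed_Collect_conj closed_Collect_le continuous_intros)
  moreover have "closed_ref_simplex \<subseteq> cbox 0 (\<chi> i. 1)"
    by (auto simp: closed_ref_simplex_def mem_box_cart forall_3)
  ultimately show ?thesis
    by (meson bounded_cbox bounded_subset compact_eq_bounded_closed)
qed

lemma open_ref_simplex: "open ref_simplex"
  unfolding ref_simplex_def
  by (intro open_Collect_conj open_Collect_less continuous_intros)

lemma ref_simplex_subset: "ref_simplex \<subseteq> closed_ref_simplex"
  by (auto simp: ref_simplex_def closed_ref_simplex_def)

definition bary_diff :: "'v::{finite,linorder} set \<Rightarrow> real ^ 3 \<Rightarrow> (real, 'v) vec" where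
  "bary_diff \<sigma> w = w $ 1 *\<^sub>R (axis (vert \<sigma> 1) 1 - axis (vert \<sigma> 0) 1)
     + w $ 2 *\<^sub>R (axis (vert \<sigma> 2) 1 - axis (vert \<sigma> 0) 1)
     + w $ 3 *\<^sub>R (axis (vert \<sigma> 3) 1 - axis (vert \<sigma> 0) 1)"

lemma bary_eq: "bary \<sigma> s = axis (vert \<sigma> 0) 1 + bary_diff \<sigma> s"
  by (simp add: bary_def bary_diff_def algebra_simps)

lemma linear_bary_diff: "linear (bary_diff \<sigma>)"
  unfolding bary_diff_def
  by (intro linearI) (simp_all add: algebra_simps)

lemma bary_has_derivative: "(bary \<sigma> has_derivative bary_diff \<sigma>) (at s)"
proof -
  have "(bary_diff \<sigma> has_derivative bary_diff \<sigma>) (at s)"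
    using linear_bary_diff by (rule linear_imp_has_derivative)
  then show ?thesis
    using has_derivative_add[OF has_derivative_const[of "axis (vert \<sigma> 0) 1"]] by (fastforce simp: bary_eq[abs_def])
qed

lemma frechet_derivative_bary [simp]: "frechet_derivative (bary \<sigma>) (at s) = bary_diff \<sigma>"
  by (rule frechet_derivative_at[OF bary_has_derivative, symmetric])

lemma continuous_on_bary: "continuous_on T (bary \<sigma>)"
  by (meson bary_has_derivative continuous_at_imp_continuous_on has_derivative_continuous)

lemma vert_distinct:
  assumes "card \<sigma> = 4" "i < 4" "j < 4"
  shows "vert \<sigma> i = vert \<sigma> j \<longleftrightarrow> i = j"
  using assms unfolding vert_def by (intro nth_eq_iff_index_eq) auto

lemma vert_in:
  fixes \<sigma> :: "'v::{finite,linorder} set"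
  assumes "card \<sigma> = 4" "i < 4"
  shows "vert \<sigma> i \<in> \<sigma>"
proof -
  have "vert \<sigma> i \<in> set (sorted_list_of_set \<sigma>)"
    unfolding vert_def using assms by (intro nth_mem) simp
  then show ?thesis by simp
qed

text \<open>These are the side conditions of the immersion clause in
  \<open>smooth_triangulation\<close>; they make the differential of a local extension injective
  after composition with \<open>bary \<sigma>\<close>.\<close>

lemma bary_diff_tangent:
  assumes "card \<sigma> = 4"
  shows "(\<Sum>v\<in>UNIV. bary_diff \<sigma> w $ v) = 0" "{v. bary_diff \<sigma> w $ v \<noteq> 0} \<subseteq> \<sigma>"
    "w \<noteq> 0 \<Longrightarrow> bary_diff \<sigma> w \<noteq> 0"
proof -
  have ax: "(\<Sum>v\<in>UNIV. axis u (1::real) $ v) = 1" for u :: 'a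
    by (simp add: axis_def)
  show "(\<Sum>v\<in>UNIV. bary_diff \<sigma> w $ v) = 0"
    by (simp add: bary_diff_def sum.distrib sum_subtractf ax flip: sum_distrib_left)
  show "{v. bary_diff \<sigma> w $ v \<noteq> 0} \<subseteq> \<sigma>"
    using vert_in[OF assms] by (auto simp: bary_diff_def axis_def split: if_splits)
  have "bary_diff \<sigma> w $ vert \<sigma> 1 = w $ 1" "bary_diff \<sigma> w $ vert \<sigma> 2 = w $ 2" "bary_diff \<sigma> w $ vert \<sigma> 3 = w $ 3"
    using vert_distinct[OF assms] by (simp_all add: bary_diff_def axis_def)
  then show "bary_diff \<sigma> w \<noteq> 0" if "w \<noteq> 0"
    using that by (metis exhaust_3 vec_eq_iff zero_index)
qed

lemma bary_mem_closed_simplex: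
  assumes "card \<sigma> = 4" "s \<in> closed_ref_simplex"
  shows "bary \<sigma> s \<in> closed_simplex \<sigma>"
proof -
  have ax: "(\<Sum>v\<in>UNIV. axis u (1::real) $ v) = 1" for u :: 'a
    by (simp add: axis_def)
  have "(\<Sum>v\<in>UNIV. bary \<sigma> s $ v) = 1"
    using bary_diff_tangent(1)[OF assms(1)] by (simp add: bary_eq sum.distrib ax)
  moreover have "0 \<le> bary \<sigma> s $ v" for v
    using assms(2) unfolding bary_def closed_ref_simplex_def vector_add_component vector_scaleR_component
    by (intro add_nonneg_nonneg mult_nonneg_nonneg) (simp_all add: axis_def)
  moreover have "{v. bary \<sigma> s $ v \<noteq> 0} \<subseteq> \<sigma>"
    using vert_in[OF assms(1)] by (auto simp: bary_def axis_def split: if_splits)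
  ultimately show ?thesis
    by (simp add: closed_simplex_def)
qed

section \<open>The Whitney inner product is bilinear\<close>

text \<open>The Gram matrix of the metric in the coordinates \<open>bary \<sigma>\<close> does not depend on the chart chosen
  by \<open>chart_around\<close>, and a smooth extension of the chart representation of the triangulation shows
  that it extends continuously, with positive determinant, to the closed tetrahedron.\<close>

lemma simplex_metric_local:
  fixes X :: "('m::t2_space, 'v::{finite,linorder}) triangulated_manifold"
  assumes X: "closed_oriented_riemannian_3manifold_triangulated X"
    and \<sigma>: "\<sigma> \<in> simplices X 3" and s0: "s0 \<in> closed_ref_simplex"
  obtains U H where "open U" "s0 \<in> U" "continuous_on U H" "\<And>s. s \<in> U \<Longrightarrow> det (H s) > 0"
    "\<And>s. s \<in> U \<inter> ref_simplex \<Longrightarrow> simplex_metric X \<sigma> s = H s"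
    "\<And>s. s \<in> U \<inter> ref_simplex \<Longrightarrow> simplex_orientation X \<sigma> s * simplex_orientation X \<sigma> s = 1"
proof -
  let ?h = "realize X"
  have atlas: "oriented_smooth_atlas (charts X)" and rm: "riemannian_metric (charts X) (metric X)"
    and tri: "smooth_triangulation (charts X) (faces X) ?h"
    using X by (simp_all add: closed_oriented_riemannian_3manifold_triangulated_def)
  have card: "card \<sigma> = 4" and face: "\<sigma> \<in> faces X"
    using \<sigma> by (simp_all add: simplices_def)
  have cover: "\<exists>c\<in>charts X. p \<in> fst c" for p
    using atlas unfolding oriented_smooth_atlas_def by blast
  have inj: "inv_into (fst c) (snd c) (snd c p) = p" if "c \<in> charts X" "p \<in> fst c" for c p
    using atlas that unfolding oriented_smooth_atlas_def homeomorphism_def by blast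
  have open_chart: "open (snd c ` fst c)" if "c \<in> charts X" for c
    using atlas that unfolding oriented_smooth_atlas_def by blast
  have ext: "\<exists>N F. open N \<and> t \<in> N \<and> smooth_on N F \<and>
      (\<forall>s\<in>N \<inter> closed_simplex \<sigma>. ?h s \<in> fst c \<and> snd c (?h s) = F s) \<and>
      (\<forall>w. w \<noteq> 0 \<and> (\<Sum>v\<in>UNIV. w $ v) = 0 \<and> {v. w $ v \<noteq> 0} \<subseteq> \<sigma> \<longrightarrow> frechet_derivative F (at t) w \<noteq> 0)"
    if "t \<in> closed_simplex \<sigma>" "c \<in> charts X" "?h t \<in> fst c" for t c
    using tri face that unfolding smooth_triangulation_def by blast
  \<comment> \<open>One chart around the image of \<open>s0\<close> is fixed here, whereas the chart
    picked by \<open>simplex_chart\<close> may change from point to point.\<close>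
  obtain c where c: "c \<in> charts X" "?h (bary \<sigma> s0) \<in> fst c"
    using cover by blast
  have b0: "bary \<sigma> s0 \<in> closed_simplex \<sigma>"
    using card s0 by (rule bary_mem_closed_simplex)
  obtain N F where N: "open N" "bary \<sigma> s0 \<in> N" and F: "smooth_on N F"
    and NF: "\<And>t. t \<in> N \<inter> closed_simplex \<sigma> \<Longrightarrow> ?h t \<in> fst c \<and> snd c (?h t) = F t"
    and imm: "\<And>w. w \<noteq> 0 \<Longrightarrow> (\<Sum>v\<in>UNIV. w $ v) = 0 \<Longrightarrow> {v. w $ v \<noteq> 0} \<subseteq> \<sigma> \<Longrightarrow>
      frechet_derivative F (at (bary \<sigma> s0)) w \<noteq> 0"
    using ext[OF b0 c] by blast
  \<comment> \<open>\<open>F\<close> has to stay inside the image of the chart, the region on which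
    \<open>metric X c\<close> is known to be continuous.\<close>
  define W where "W = bary \<sigma> -` N \<inter> (F \<circ> bary \<sigma>) -` (snd c ` fst c)"
  define J where "J s = jacobian (F \<circ> bary \<sigma>) (at s)" for s
  define H where "H s = transpose (J s) ** metric X c (F (bary \<sigma> s)) ** J s" for s
  have Fb_deriv: "(F \<circ> bary \<sigma> has_derivative (frechet_derivative F (at (bary \<sigma> s)) \<circ> bary_diff \<sigma>)) (at s)"
    if "bary \<sigma> s \<in> N" for s
    using smooth_on_differentiable[OF F that] 
    by (intro diff_chain_at bary_has_derivative) (simp add: frechet_derivative_works)
  have J_apply: "J s *v w = frechet_derivative F (at (bary \<sigma> s)) (bary_diff \<sigma> w)"
    if s: "bary \<sigma> s \<in> N" for s w
  proof -
    have "J s = matrix (frechet_derivative F (at (bary \<sigma> s)) \<circ> bary_diff \<sigma>)"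
      unfolding J_def jacobian_def frechet_derivative_at[OF Fb_deriv[OF s], symmetric] ..
    then show ?thesis
      using matrix_works[OF linear_matrix_vector_mul_eq[THEN iffD2, OF has_derivative_linear[OF Fb_deriv[OF s]]], of w] by simp
  qed
  have oN: "open (bary \<sigma> -` N)"
    using N(1) continuous_on_bary by (rule open_vimage)
  have cF: "continuous_on (bary \<sigma> -` N) (F \<circ> bary \<sigma>)"
    using smooth_on_continuous_on[OF F] by (intro continuous_on_compose continuous_on_bary) (auto elim: continuous_on_subset)
  have oW: "open W"
    unfolding W_def using cF oN open_chart[OF c(1)] by (rule continuous_open_preimage)
  have s0W: "s0 \<in> W"
    using N b0 NF[of "bary \<sigma> s0"] by (auto simp: W_def intro: rev_image_eqI)
  have cJ: "continuous_on W J"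
  proof -
    have "continuous_on W (\<lambda>s. \<chi> i j. frechet_derivative F (at (bary \<sigma> s)) (bary_diff \<sigma> (axis j 1)) $ i)"
      by (intro continuous_on_vec_lambda continuous_on_component
          continuous_on_compose2[OF smooth_on_continuous_on_derivative[OF F] continuous_on_bary])
         (auto simp: W_def)
    then show ?thesis
    proof (rule continuous_on_eq)
      fix s assume "s \<in> W"
      then have "J s $ i $ j = frechet_derivative F (at (bary \<sigma> s)) (bary_diff \<sigma> (axis j 1)) $ i" for i j
        using J_apply[of s "axis j 1", symmetric] by (simp add: W_def matrix_vector_mult_basis column_def)
      then show "(\<chi> i j. frechet_derivative F (at (bary \<sigma> s)) (bary_diff \<sigma> (axis j 1)) $ i) = J s"
        by (simp add: vec_eq_iff)
    qed
  qed
  have "continuous_on (snd c ` fst c) (metric X c)"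
    using rm c(1) by (simp add: riemannian_metric_def smooth_on_continuous_on)
  then have "continuous_on W (\<lambda>s. metric X c ((F \<circ> bary \<sigma>) s))"
    by (rule continuous_on_compose2) (use cF in \<open>auto simp: W_def elim: continuous_on_subset\<close>)
  then have cH: "continuous_on W H"
    unfolding H_def using cJ
    by (intro continuous_on_matrix_matrix_mult continuous_on_matrix_transpose) auto
  \<comment> \<open>The immersion condition is applied at \<open>s0\<close> only; by continuity the
    determinant stays positive nearby, which is how \<open>U\<close> is obtained.\<close>
  have "pos_def (H s0)"
    unfolding H_def
  proof (rule pos_def_congruence)
    have "F (bary \<sigma> s0) \<in> snd c ` fst c"
      using s0W by (simp add: W_def)
    then show "pos_def (metric X c (F (bary \<sigma> s0)))"
      using rm c(1) unfolding riemannian_metric_def by blast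
    show "J s0 *v x \<noteq> 0" if "x \<noteq> 0" for x
      using imm[OF bary_diff_tangent(3)[OF card that] bary_diff_tangent(1)[OF card] bary_diff_tangent(2)[OF card]]
        J_apply N(2) by simp
  qed
  then have H0: "det (H s0) > 0"
    by (rule pos_def_det_pos)
  define U where "U = W \<inter> (\<lambda>s. det (H s)) -` {0<..}"
  have oU: "open U"
    unfolding U_def using continuous_on_matrix_det[OF cH] oW by (rule continuous_open_preimage) simp
  have s0U: "s0 \<in> U"
    using s0W H0 by (simp add: U_def)
  have rep: "simplex_metric X \<sigma> s = H s \<and> simplex_orientation X \<sigma> s * simplex_orientation X \<sigma> s = 1"
    if "s \<in> U \<inter> ref_simplex" for s
  proof -
    have sW: "s \<in> W" and sref: "s \<in> ref_simplex" and dH: "det (H s) > 0"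
      using that by (auto simp: U_def)
    have bs: "bary \<sigma> s' \<in> closed_simplex \<sigma>" if "s' \<in> ref_simplex" for s'
      using bary_mem_closed_simplex[OF card] ref_simplex_subset that by blast
    define c' where "c' = simplex_chart X \<sigma> s"
    have "c' \<in> charts X \<and> ?h (bary \<sigma> s) \<in> fst c'"
      unfolding c'_def simplex_chart_def chart_around_def using cover[of "?h (bary \<sigma> s)"]
      by (intro someI_ex[of "\<lambda>c. c \<in> charts X \<and> ?h (bary \<sigma> s) \<in> fst c"]) blast
    then have c': "c' \<in> charts X" "?h (bary \<sigma> s) \<in> fst c'" by auto
    obtain N' F' where N': "open N'" "bary \<sigma> s \<in> N'"
      and NF': "\<And>t. t \<in> N' \<inter> closed_simplex \<sigma> \<Longrightarrow> ?h t \<in> fst c' \<and> snd c' (?h t) = F' t"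
      using ext[OF bs[OF sref] c'] by blast
    let ?T = "transition c c'"
    let ?x = "F (bary \<sigma> s)"
    have sN: "bary \<sigma> s \<in> N" using sW by (simp add: W_def)
    have hc: "?h (bary \<sigma> s) \<in> fst c" "snd c (?h (bary \<sigma> s)) = ?x"
      using NF[of "bary \<sigma> s"] sN bs[OF sref] by auto
    have x: "?x \<in> snd c ` (fst c \<inter> fst c')"
      using hc c' by (metis IntI imageI)
    have T: "?T differentiable (at ?x)" 
      using atlas c(1) c'(1) x unfolding oriented_smooth_atlas_def by (meson smooth_on_differentiable)
    have Fb: "F \<circ> bary \<sigma> differentiable (at s)"
      using Fb_deriv[OF sN] by (auto simp: differentiable_def)
    \<comment> \<open>\<open>F\<close> represents the triangulation only on the closed simplex, but
      \<open>bary \<sigma>\<close> maps the open reference tetrahedron into it. On \<open>?V\<close>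
      the two composites therefore agree on a full neighbourhood of \<open>s\<close> and have the
      same derivative, although \<open>realize X\<close> is not controlled off the complex.\<close>
    let ?V = "bary \<sigma> -` N \<inter> bary \<sigma> -` N' \<inter> ref_simplex"
    have V: "open ?V" "s \<in> ?V"
      using oN open_vimage[OF N'(1) continuous_on_bary] open_ref_simplex sN N'(2) sref by auto
    have Veq: "(?T \<circ> (F \<circ> bary \<sigma>)) s' = (snd c' \<circ> ?h \<circ> bary \<sigma>) s'" if "s' \<in> ?V" for s'
    proof -
      have "?h (bary \<sigma> s') \<in> fst c" "snd c (?h (bary \<sigma> s')) = F (bary \<sigma> s')"
        using NF[of "bary \<sigma> s'"] bs that by auto
      then show ?thesis
        using inj[OF c(1)] by (metis comp_apply transition_def)
    qed
    have "(?T has_derivative (*v) (jacobian ?T (at ?x))) (at ((F \<circ> bary \<sigma>) s))"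
      using T by (simp add: jacobian_works)
    moreover have "(F \<circ> bary \<sigma> has_derivative (*v) (J s)) (at s)"
      using Fb by (simp add: jacobian_works J_def)
    ultimately have "(?T \<circ> (F \<circ> bary \<sigma>) has_derivative (*v) (jacobian ?T (at ?x)) \<circ> (*v) (J s)) (at s)"
      by (intro diff_chain_at)
    then have "(snd c' \<circ> ?h \<circ> bary \<sigma> has_derivative (*v) (jacobian ?T (at ?x)) \<circ> (*v) (J s)) (at s)"
      using V Veq by (rule has_derivative_transform_within_open)
    then have "frechet_derivative (snd c' \<circ> ?h \<circ> bary \<sigma>) (at s) = (*v) (jacobian ?T (at ?x) ** J s)"
      by (simp add: frechet_derivative_at[symmetric] matrix_vector_mult_matrix_matrix_mult_compose)
    then have Js: "simplex_jacobian X \<sigma> s = jacobian ?T (at ?x) ** J s"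
      by (simp add: simplex_jacobian_def c'_def[symmetric] jacobian_def)
    have g: "metric X c ?x = transpose (jacobian ?T (at ?x)) ** metric X c' (?T ?x) ** jacobian ?T (at ?x)"
      using rm c(1) c'(1) x unfolding riemannian_metric_def by blast
    have Tx: "?T ?x = snd c' (?h (bary \<sigma> s))"
      using Veq[OF V(2)] by simp
    \<comment> \<open>The transformation law \<open>g\<close> absorbs the transition Jacobian
      contained in \<open>Js\<close>, so the chart chosen at \<open>s\<close> disappears.\<close>
    have metric: "simplex_metric X \<sigma> s = H s"
      by (simp add: simplex_metric_def Let_def c'_def[symmetric] Js H_def g Tx matrix_transpose_mul matrix_mul_assoc)
    \<comment> \<open>A priori the sign of the Jacobian could be 0; the positive determinant of the
      metric excludes this.\<close>
    have "det (simplex_metric X \<sigma> s) = det (simplex_jacobian X \<sigma> s) * det (metric X c' (snd c' (?h (bary \<sigma> s)))) * det (simplex_jacobian X \<sigma> s)"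
      by (simp add: simplex_metric_def Let_def c'_def[symmetric] det_mul)
    then have "det (simplex_jacobian X \<sigma> s) \<noteq> 0"
      using dH metric by auto
    then have "simplex_orientation X \<sigma> s * simplex_orientation X \<sigma> s = 1"
      by (simp add: simplex_orientation_def sgn_if)
    with metric show ?thesis by simp
  qed
  show ?thesis
    using oU s0U rep continuous_on_subset[OF cH, of U] by (intro that[of U H]) (auto simp: U_def)
qed

text \<open>On one-forms this is \<open>sqrt (det G)\<close> times the inner product dual to
  \<open>G\<close>. The orientation sign is split off because the rest depends continuously on
  \<open>G\<close> as long as the determinant stays positive.\<close>

definition hodge_pairing :: "real ^ 3 ^ 3 \<Rightarrow> (real ^ 3) covector \<Rightarrow> (real ^ 3) covector \<Rightarrow> real" where
  "hodge_pairing G \<alpha> \<beta> = wedge 1 2 \<alpha> (hodge_star 1 G 1 \<beta>) [axis 1 1, axis 2 1, axis 3 1]"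

lemma hodge_star_orientation: "hodge_star \<epsilon> G k \<beta> = (\<lambda>ws. \<epsilon> * hodge_star 1 G k \<beta> ws)"
  by (simp add: hodge_star_def fun_eq_iff)

lemma hodge_star_add:
  "hodge_star \<epsilon> G k (\<lambda>ws. \<alpha> ws + \<beta> ws) = (\<lambda>ws. hodge_star \<epsilon> G k \<alpha> ws + hodge_star \<epsilon> G k \<beta> ws)"
  by (simp add: hodge_star_def fun_eq_iff algebra_simps sum.distrib)

lemma hodge_star_scale:
  "hodge_star \<epsilon> G k (\<lambda>ws. c * \<beta> ws) = (\<lambda>ws. c * hodge_star \<epsilon> G k \<beta> ws)"
  by (simp add: hodge_star_def fun_eq_iff sum_distrib_left ac_simps)

lemma wedge_add_left: "wedge k l (\<lambda>ws. \<alpha> ws + \<alpha>' ws) \<beta> ws = wedge k l \<alpha> \<beta> ws + wedge k l \<alpha>' \<beta> ws"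
  by (simp add: wedge_def algebra_simps sum.distrib add_divide_distrib)

lemma wedge_scale_left: "wedge k l (\<lambda>ws. c * \<alpha> ws) \<beta> ws = c * wedge k l \<alpha> \<beta> ws"
  by (simp add: wedge_def sum_distrib_left ac_simps)

lemma wedge_add_right: "wedge k l \<alpha> (\<lambda>ws. \<beta> ws + \<beta>' ws) ws = wedge k l \<alpha> \<beta> ws + wedge k l \<alpha> \<beta>' ws"
  by (simp add: wedge_def algebra_simps sum.distrib add_divide_distrib)

lemma wedge_scale_right: "wedge k l \<alpha> (\<lambda>ws. c * \<beta> ws) ws = c * wedge k l \<alpha> \<beta> ws"
  by (simp add: wedge_def sum_distrib_left ac_simps)

lemma continuous_on_hodge_pairing:
  assumes "continuous_on U H" "\<And>s. s \<in> U \<Longrightarrow> det (H s) > 0"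
    and "\<And>ws. continuous_on U (\<lambda>s. \<alpha> s ws)" "\<And>ws. continuous_on U (\<lambda>s. \<beta> s ws)"
  shows "continuous_on U (\<lambda>s. hodge_pairing (H s) (\<alpha> s) (\<beta> s))"
proof -
  have nz: "det (H s) \<noteq> 0" if "s \<in> U" for s
    using assms(2)[OF that] by simp
  show ?thesis
    unfolding hodge_pairing_def wedge_def hodge_star_def
    by (intro continuous_on_divide continuous_on_sum continuous_on_mult continuous_on_prod
        continuous_on_const continuous_on_real_sqrt continuous_on_matrix_det continuous_on_matrix_inv_nth
        assms nz) auto
qed

lemma continuous_on_pullback_whitney_map:
  "continuous_on U (\<lambda>s. pullback (bary \<sigma>) (whitney_map X k u) s ws)"
  unfolding pullback_def whitney_map_def whitney_form_def Let_def frechet_derivative_bary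
  by (intro continuous_on_sum continuous_on_mult continuous_on_const continuous_on_component continuous_on_bary)

lemma pullback_whitney_map_add:
  "pullback f (whitney_map X k (u + v)) s =
    (\<lambda>ws. pullback f (whitney_map X k u) s ws + pullback f (whitney_map X k v) s ws)"
  by (simp add: pullback_def whitney_map_def fun_eq_iff algebra_simps sum.distrib)

lemma pullback_whitney_map_scale:
  "pullback f (whitney_map X k (c *\<^sub>R u)) s = (\<lambda>ws. c * pullback f (whitney_map X k u) s ws)"
  by (simp add: pullback_def whitney_map_def fun_eq_iff sum_distrib_left ac_simps)

text \<open>The orientation occurs twice, once from the integral of a 3-form and once from the Hodge
  star, so the signs cancel wherever the Jacobian is nonsingular.\<close>

definition whitney_integrand ::
  "('m::t2_space, 'v::{finite,linorder}) triangulated_manifold \<Rightarrow> 'v set \<Rightarrow> 'v cochain \<Rightarrow> 'v cochain \<Rightarrow> real ^ 3 \<Rightarrow> real" where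
  "whitney_integrand X \<sigma> u v s = simplex_orientation X \<sigma> s * simplex_orientation X \<sigma> s
    * hodge_pairing (simplex_metric X \<sigma> s)
        (pullback (bary \<sigma>) (whitney_map X 1 u) s) (pullback (bary \<sigma>) (whitney_map X 1 v) s)"

lemma whitney_inner_eq:
  "whitney_inner X 1 u v =
    (\<Sum>\<sigma>\<in>simplices X 3. LINT s:ref_simplex|lborel. whitney_integrand X \<sigma> u v s)"
  unfolding whitney_inner_def integral_3form_def whitney_integrand_def
  by (subst hodge_star_orientation) (simp add: wedge_scale_right hodge_pairing_def ac_simps)

lemma set_integrable_whitney_integrand:
  assumes "closed_oriented_riemannian_3manifold_triangulated X" "\<sigma> \<in> simplices X 3"
  shows "set_integrable lborel ref_simplex (whitney_integrand X \<sigma> u v)"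
proof (rule set_integrable_locally_continuous[OF compact_closed_ref_simplex ref_simplex_subset open_ref_simplex])
  fix s0 assume "s0 \<in> closed_ref_simplex"
  then obtain U H where U: "open U" "s0 \<in> U" "continuous_on U H" "\<And>s. s \<in> U \<Longrightarrow> det (H s) > 0"
    and H: "\<And>s. s \<in> U \<inter> ref_simplex \<Longrightarrow> simplex_metric X \<sigma> s = H s"
      "\<And>s. s \<in> U \<inter> ref_simplex \<Longrightarrow> simplex_orientation X \<sigma> s * simplex_orientation X \<sigma> s = 1"
    using simplex_metric_local[OF assms] by blast
  let ?h = "\<lambda>s. hodge_pairing (H s)
    (pullback (bary \<sigma>) (whitney_map X 1 u) s) (pullback (bary \<sigma>) (whitney_map X 1 v) s)"
  have "continuous_on U ?h"
    using U(3,4) by (intro continuous_on_hodge_pairing continuous_on_pullback_whitney_map)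
  moreover have "\<forall>s\<in>U \<inter> ref_simplex. whitney_integrand X \<sigma> u v s = ?h s"
    using H by (simp add: whitney_integrand_def)
  ultimately show "\<exists>U h. open U \<and> s0 \<in> U \<and> continuous_on U h \<and>
      (\<forall>s\<in>U \<inter> ref_simplex. whitney_integrand X \<sigma> u v s = h s)"
    using U by blast
qed

lemma bilinear_whitney_inner:
  assumes X: "closed_oriented_riemannian_3manifold_triangulated X"
  shows "bilinear (whitney_inner X 1)"
proof -
  note int = set_integrable_whitney_integrand[OF X]
  have add_left: "whitney_integrand X \<sigma> (u + u') v = (\<lambda>s. whitney_integrand X \<sigma> u v s + whitney_integrand X \<sigma> u' v s)"
    and scale_left: "whitney_integrand X \<sigma> (c *\<^sub>R u) v = (\<lambda>s. c * whitney_integrand X \<sigma> u v s)"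
    and add_right: "whitney_integrand X \<sigma> v (u + u') = (\<lambda>s. whitney_integrand X \<sigma> v u s + whitney_integrand X \<sigma> v u' s)"
    and scale_right: "whitney_integrand X \<sigma> v (c *\<^sub>R u) = (\<lambda>s. c * whitney_integrand X \<sigma> v u s)"
    for \<sigma> u u' v c
    by (simp_all add: whitney_integrand_def hodge_pairing_def fun_eq_iff pullback_whitney_map_add
        pullback_whitney_map_scale hodge_star_add hodge_star_scale wedge_add_left wedge_add_right
        wedge_scale_left wedge_scale_right distrib_left)
  have "linear (\<lambda>u. whitney_inner X 1 u v)" for v
    unfolding whitney_inner_eq
    by (intro linearI)
      (simp_all add: add_left scale_left set_integral_add int sum.distrib sum_distrib_left)
  moreover have "linear (whitney_inner X 1 v)" for v
    unfolding whitney_inner_eq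
    by (intro linearI)
      (simp_all add: add_right scale_right set_integral_add int sum.distrib sum_distrib_left)
  ultimately show ?thesis
    by (simp add: bilinear_def)
qed

section \<open>Physical and gauge coordinates\<close>

text \<open>The inverse of \<open>coords\<close> on the span of a Whitney-orthonormal
  family.\<close>

definition lincomb :: "('n::finite \<Rightarrow> 'v cochain) \<Rightarrow> real ^ 'n \<Rightarrow> 'v::finite cochain" where
  "lincomb e c = (\<Sum>i\<in>UNIV. c $ i *\<^sub>R e i)"

lemma linear_lincomb: "linear (lincomb e)"
  unfolding lincomb_def by (intro linearI) (simp_all add: scaleR_add_left sum.distrib scaleR_right.sum)

lemma range_lincomb: "range (lincomb e) = span (range e)"
proof -
  have ax: "lincomb e (axis i 1) = e i" for i
    by (simp add: lincomb_def axis_def if_distrib[of "\<lambda>c. c *\<^sub>R _"] cong: if_cong)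
  have "range (lincomb e) = lincomb e ` span Basis"
    by simp
  also have "\<dots> = span (lincomb e ` Basis)"
    by (rule linear_span_image[OF linear_lincomb, symmetric])
  also have "lincomb e ` Basis = range e"
    by (auto simp: Basis_vec_def ax image_iff)
  finally show ?thesis .
qed

context
  fixes X :: "('m::t2_space, 'v::{finite,linorder}) triangulated_manifold"
  assumes X: "closed_oriented_riemannian_3manifold_triangulated X"
begin

private lemma lin_left: "linear (\<lambda>u. whitney_inner X 1 u v)"
  and lin_right: "linear (whitney_inner X 1 v)"
  using bilinear_whitney_inner[OF X] by (simp_all add: bilinear_def)

lemma linear_coords: "linear (coords X e)"
  unfolding coords_def
  by (intro linearI) (simp_all add: vec_eq_iff linear_add[OF lin_left] linear_scale[OF lin_left] del: One_nat_def)

lemma coords_lincomb: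
  assumes "whitney_orthonormal_basis X V e"
  shows "coords X e (lincomb e c) = c"
proof -
  have "whitney_inner X 1 (lincomb e c) (e j) = (\<Sum>i\<in>UNIV. c $ i * whitney_inner X 1 (e i) (e j))" for j
    unfolding lincomb_def by (simp add: linear_sum[OF lin_left] linear_scale[OF lin_left] del: One_nat_def)
  moreover have "whitney_inner X 1 (e i) (e j) = (if i = j then 1 else 0)" for i j
    using assms unfolding whitney_orthonormal_basis_def by blast
  ultimately show ?thesis
    by (simp add: coords_def vec_eq_iff if_distrib cong: if_cong del: One_nat_def)
qed

text \<open>\<open>coords\<close> is a left inverse of \<open>lincomb\<close>, so
  \<open>lincomb\<close> is an isomorphism onto \<open>V\<close>. For the gauge space this
  identifies \<open>q\<close> with the size of the index type.\<close>

lemma dim_whitney_orthonormal_basis: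
  fixes e :: "'n::finite \<Rightarrow> 'v cochain"
  assumes "whitney_orthonormal_basis X V e"
  shows "dim V = CARD('n)"
proof -
  have "inj (lincomb e)"
    using coords_lincomb[OF assms] by (metis injI)
  then have "dim (range (lincomb e)) = dim (UNIV :: (real ^ 'n) set)"
    using linear_lincomb by (intro dim_image_eq) (auto simp: inj_on_def)
  then have "dim (span (range e)) = CARD('n)"
    by (simp add: range_lincomb)
  then show ?thesis
    using assms unfolding whitney_orthonormal_basis_def by metis
qed

text \<open>A residual is orthogonal to the space exactly when its coordinates vanish, so the
  description asks for an element of the space with the same coordinates as \<open>a\<close>;
  existence and uniqueness both come from \<open>coords_lincomb\<close>.\<close>

lemma phys_proj_eq:
  assumes e: "whitney_orthonormal_basis X (phys_space X) e"
  shows "phys_proj X a = lincomb e (coords X e a)"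
proof -
  have V: "phys_space X = range (lincomb e)"
    using e by (simp add: whitney_orthonormal_basis_def range_lincomb)
  have eV: "e i \<in> phys_space X" for i
    using e unfolding whitney_orthonormal_basis_def by (metis rangeI span_base)
  have orth: "(\<forall>w\<in>phys_space X. whitney_inner X 1 u w = 0) \<longleftrightarrow> coords X e u = 0" for u
  proof
    assume "\<forall>w\<in>phys_space X. whitney_inner X 1 u w = 0"
    then show "coords X e u = 0"
      using eV by (simp add: coords_def vec_eq_iff)
  next
    assume "coords X e u = 0"
    then have "whitney_inner X 1 u (e i) = 0" for i
      by (simp add: coords_def vec_eq_iff)
    then have "whitney_inner X 1 u (lincomb e c) = 0" for c
      unfolding lincomb_def by (simp add: linear_sum[OF lin_right] linear_scale[OF lin_right] del: One_nat_def)
    then show "\<forall>w\<in>phys_space X. whitney_inner X 1 u w = 0"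
      unfolding V by blast
  qed
  show ?thesis
    unfolding phys_proj_def orth linear_diff[OF linear_coords]
  proof (rule the_equality)
    show "lincomb e (coords X e a) \<in> phys_space X \<and> coords X e a - coords X e (lincomb e (coords X e a)) = 0"
      by (simp add: V coords_lincomb[OF e])
    show "x = lincomb e (coords X e a)" if "x \<in> phys_space X \<and> coords X e a - coords X e x = 0" for x
      using that coords_lincomb[OF e] unfolding V by auto
  qed
qed

lemma borel_measurable_coords: "coords X e \<in> borel_measurable borel"
  using linear_coords by (intro borel_measurable_continuous_onI linear_continuous_on) (simp add: linear_linear)

lemma borel_measurable_lincomb: "lincomb e \<in> borel_measurable borel"
  using linear_lincomb by (intro borel_measurable_continuous_onI linear_continuous_on) (simp add: linear_linear)

lemma measurable_coords_restrict:
  assumes "sets M = sets (restrict_space borel \<Omega>)"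
  shows "coords X e \<in> M \<rightarrow>\<^sub>M borel"
  using measurable_restrict_space1[OF borel_measurable_coords] assms
  by (simp cong: measurable_cong_sets)

lemma measurable_coords2:
  assumes "sets M = sets (restrict_space borel \<Omega>)"
  shows "coords2 X eP eG \<in> M \<rightarrow>\<^sub>M borel"
  unfolding coords2_def[abs_def]
  by (intro borel_measurable_Pair measurable_coords_restrict[OF assms])

text \<open>Projecting does not change the physical coordinates, so in coordinates the marginal is
  an image of \<open>\<mu>\<close> itself.\<close>

lemma distr_phys_marginal:
  assumes e: "whitney_orthonormal_basis X (phys_space X) e"
    and \<mu>: "sets \<mu> = sets (restrict_space borel (cochains X 1))"
  shows "distr (phys_marginal X \<mu>) lborel (coords X e) = distr \<mu> lborel (coords X e)"
proof -
  have V: "phys_space X = range (lincomb e)"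
    using e by (simp add: whitney_orthonormal_basis_def range_lincomb)
  have "phys_proj X = lincomb e \<circ> coords X e"
    by (simp add: fun_eq_iff phys_proj_eq[OF e])
  then have m: "phys_proj X \<in> \<mu> \<rightarrow>\<^sub>M restrict_space borel (phys_space X)"
    using measurable_comp[OF measurable_coords_restrict[OF \<mu>] borel_measurable_lincomb]
    by (intro measurable_restrict_space2) (auto simp: V)
  have "coords X e \<in> restrict_space borel (phys_space X) \<rightarrow>\<^sub>M lborel"
    using measurable_coords_restrict[OF refl] by simp
  then show ?thesis
    unfolding phys_marginal_def using m
    by (simp add: distr_distr comp_def phys_proj_eq[OF e] coords_lincomb[OF e])
qed

end

section \<open>Marginal and conditional densities in coordinates\<close>

lemma distr_fst_density:
  fixes g :: "'a::euclidean_space \<Rightarrow> ennreal" and h :: "'a \<Rightarrow> 'b::euclidean_space \<Rightarrow> ennreal"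
  assumes [measurable]: "g \<in> borel_measurable borel" "case_prod h \<in> borel_measurable (borel \<Otimes>\<^sub>M borel)"
    and h: "\<And>x. (\<integral>\<^sup>+y. h x y \<partial>lborel) = 1"
  shows "distr (density lborel (\<lambda>(x, y). g x * h x y)) lborel fst = density lborel g"
proof (rule measure_eqI)
  fix E assume "E \<in> sets (distr (density lborel (\<lambda>(x, y). g x * h x y)) lborel fst)"
  then have E[measurable]: "E \<in> sets borel" by simp
  have "fst -` E \<in> sets (borel \<Otimes>\<^sub>M (borel :: 'b measure))"
    using measurable_sets[OF measurable_fst E, of borel] by (simp add: space_pair_measure)
  note this[measurable]
  have [measurable]: "case_prod h \<in> borel_measurable (lborel \<Otimes>\<^sub>M lborel)"
    using assms(2) by (simp cong: measurable_cong_sets)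
  have "emeasure (distr (density (lborel \<Otimes>\<^sub>M lborel) (\<lambda>(x, y). g x * h x y)) lborel fst) E
    = (\<integral>\<^sup>+z. (g (fst z) * h (fst z) (snd z)) * indicator E (fst z) \<partial>(lborel \<Otimes>\<^sub>M lborel))"
    by (subst emeasure_distr, measurable, subst emeasure_density)
       (auto simp: space_pair_measure case_prod_unfold indicator_def intro!: nn_integral_cong)
  also have "\<dots> = (\<integral>\<^sup>+x. \<integral>\<^sup>+y. (g x * indicator E x) * h x y \<partial>lborel \<partial>lborel)"
    by (subst lborel.nn_integral_fst[symmetric]) (auto simp: ac_simps)
  also have "\<dots> = (\<integral>\<^sup>+x. g x * indicator E x \<partial>lborel)"
    by (simp add: nn_integral_cmult h)
  also have "\<dots> = emeasure (density lborel g) E"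
    by (simp add: emeasure_density)
  finally show "emeasure (distr (density lborel (\<lambda>(x, y). g x * h x y)) lborel fst) E = emeasure (density lborel g) E"
    by (simp only: lborel_prod)
qed simp

lemma AE_lborel_RN_deriv_density:
  assumes "f \<in> borel_measurable borel" "\<And>x. 0 \<le> f x"
  shows "AE x in lborel. enn2real (RN_deriv lborel (density lborel (\<lambda>x. ennreal (f x))) x) = f x"
proof -
  have "AE x in lborel. ennreal (f x) = RN_deriv lborel (density lborel (\<lambda>x. ennreal (f x))) x"
    using assms(1) by (intro sigma_finite_measure.RN_deriv_unique[OF sigma_finite_lborel]) auto
  then show ?thesis
  proof eventually_elim
    case (elim x)
    then show ?case using assms(2)[of x] by (simp flip: elim)
  qed
qed

lemma AE_gaussian_if_AE_lborel:
  assumes "AE x in lborel. P x"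
  shows "AE x in gaussian m \<Sigma>. P x"
  using assms unfolding gaussian_def by (subst AE_density) auto

lemma borel_measurable_joint_density: "joint_density X eP eG \<mu> \<in> borel_measurable borel"
  unfolding joint_density_def[abs_def]
  using borel_measurable_RN_deriv[of lborel] by simp

lemma borel_measurable_phys_density: "phys_density X eP \<mu> \<in> borel_measurable borel"
  unfolding phys_density_def[abs_def]
  using borel_measurable_RN_deriv[of lborel] by simp

lemma borel_measurable_gauge_density:
  "(\<lambda>(x, y). joint_density X eP eG \<mu> (x, y) / phys_density X eP \<mu> x) \<in> borel_measurable (borel \<Otimes>\<^sub>M lborel)"
proof -
  have 1: "joint_density X eP eG \<mu> \<in> borel_measurable (borel \<Otimes>\<^sub>M borel)"
    using borel_measurable_joint_density by (simp add: borel_prod)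
  have "(\<lambda>z. joint_density X eP eG \<mu> z / phys_density X eP \<mu> (fst z)) \<in> borel_measurable (borel \<Otimes>\<^sub>M borel)"
    by (intro borel_measurable_divide 1 measurable_compose[OF measurable_fst borel_measurable_phys_density])
  then show ?thesis
    by (simp add: case_prod_unfold cong: measurable_cong_sets)
qed

text \<open>The conditionals are known to be Gaussian only almost everywhere, whereas integrability
  requires Borel measurability at every \<open>x\<close>.\<close>

lemma borel_measurable_relative_entropy_gauge:
  "(\<lambda>x. relative_entropy (gauge_conditional X eP eG \<mu> x) (gauge_conditional X eP eG \<nu> x)) \<in> borel_measurable borel"
  unfolding relative_entropy_def gauge_conditional_def
  by (intro lborel.borel_measurable_KL_divergence_density borel_measurable_gauge_density)
     (auto simp: joint_density_def phys_density_def)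

context
  fixes X :: "('m::t2_space, 'v::{finite,linorder}) triangulated_manifold"
    and eP :: "'p::finite \<Rightarrow> 'v cochain" and eG :: "'g::finite \<Rightarrow> 'v cochain"
    and \<mu> :: "'v cochain measure"
    and mp :: "real ^ 'p" and mg :: "real ^ 'g"
    and A :: "real ^ 'p ^ 'p" and B :: "real ^ 'g ^ 'p" and C :: "real ^ 'g ^ 'g"
    and R :: "real ^ 'p ^ 'g" and S :: "real ^ 'g ^ 'g"
  assumes X: "closed_oriented_riemannian_3manifold_triangulated X"
    and eP: "whitney_orthonormal_basis X (phys_space X) eP"
    and \<mu>: "nondegenerate_gaussian X eP eG \<mu> (block_vec mp mg) (block_mat A B (transpose B) C)"
    and R: "R = transpose B ** matrix_inv A"
    and S: "S = C - transpose B ** matrix_inv A ** B"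
begin

private lemma pd: "pos_def (block_mat A B (transpose B) C)"
  and sets_\<mu>: "sets \<mu> = sets (restrict_space borel (cochains X 1))"
  and distr_\<mu>: "distr \<mu> lborel (coords2 X eP eG) =
       density lborel (\<lambda>(x, y). ennreal (gaussian_density (block_vec mp mg) (block_mat A B (transpose B) C) (block_vec x y)))"
  using \<mu> by (simp_all add: nondegenerate_gaussian_def)

private lemma pdA: "pos_def A"
  using pd by (rule pos_def_block_mat_A)

lemma pos_def_gauge_covariance: "pos_def S"
  by (rule pos_def_Schur_complement[OF pd R S])

private lemma density_nonneg: "gaussian_density mp A x \<ge> 0" "gaussian_density m S y \<ge> 0"
  using gaussian_density_pos[OF pdA] gaussian_density_pos[OF pos_def_gauge_covariance]
  by (simp_all add: less_imp_le)

private lemma density_block: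
  "gaussian_density (block_vec mp mg) (block_mat A B (transpose B) C) (block_vec x y) =
    gaussian_density mp A x * gaussian_density (mg + R *v (x - mp)) S y"
  by (rule gaussian_density_block[OF pd R S])

private lemma borel_measurable_conditional_density:
  "(\<lambda>(x, y). gaussian_density (mg + R *v (x - mp)) S y) \<in> borel_measurable (borel \<Otimes>\<^sub>M borel)"
  unfolding gaussian_density_def by measurable

text \<open>\<open>coords X eP\<close> is the first component of \<open>coords2\<close>, and the
  second factor of the joint density integrates to 1 for every \<open>x\<close>.\<close>

lemma distr_phys_coords: "distr (phys_marginal X \<mu>) lborel (coords X eP) = gaussian mp A"
proof -
  have "distr \<mu> lborel (coords X eP) = distr (distr \<mu> lborel (coords2 X eP eG)) lborel fst"
    using measurable_coords2[OF X sets_\<mu>, of eP eG]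
    by (subst distr_distr) (auto simp: comp_def coords2_def measurable_fst'' simp flip: borel_prod)
  also have "\<dots> = distr (density lborel (\<lambda>(x, y). ennreal (gaussian_density mp A x)
      * ennreal (gaussian_density (mg + R *v (x - mp)) S y))) lborel fst"
    unfolding distr_\<mu> density_block by (simp add: ennreal_mult density_nonneg)
  also have "\<dots> = density lborel (\<lambda>x. ennreal (gaussian_density mp A x))"
  proof (rule distr_fst_density)
    show "(\<lambda>(x, y). ennreal (gaussian_density (mg + R *v (x - mp)) S y)) \<in> borel_measurable (borel \<Otimes>\<^sub>M borel)"
      using borel_measurable_conditional_density by (simp add: case_prod_unfold)
    show "(\<integral>\<^sup>+y. ennreal (gaussian_density (mg + R *v (x - mp)) S y) \<partial>lborel) = 1" for x
      using prob_space.emeasure_space_1[OF prob_space_gaussian[OF pos_def_gauge_covariance, of "mg + R *v (x - mp)"]]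
      by (simp add: gaussian_def emeasure_density)
  qed simp
  finally show ?thesis
    by (simp add: distr_phys_marginal[OF X eP sets_\<mu>] gaussian_def)
qed

text \<open>The conditional is built from fixed versions of two Radon-Nikodym derivatives, each
  equal to its explicit density only up to a null set. Fubini turns the joint null set into null
  sections for almost every \<open>x\<close>, and a change of density on a null set leaves the
  measure alone.\<close>

lemma AE_gauge_conditional:
  "AE x in lborel. gauge_conditional X eP eG \<mu> x = gaussian (mg + R *v (x - mp)) S"
proof -
  have phys: "AE x in lborel. phys_density X eP \<mu> x = gaussian_density mp A x"
    unfolding phys_density_def distr_phys_coords gaussian_def
    by (intro AE_lborel_RN_deriv_density density_nonneg) simp
  define f where "f z = gaussian_density mp A (fst z) * gaussian_density (mg + R *v (fst z - mp)) S (snd z)" for z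
  have "f \<in> borel_measurable borel"
  proof -
    have "f \<in> borel_measurable (borel \<Otimes>\<^sub>M borel)"
      unfolding f_def[abs_def] using borel_measurable_conditional_density
      by (intro borel_measurable_times) (auto simp: case_prod_unfold)
    then show ?thesis by (simp add: borel_prod)
  qed
  moreover have "f z \<ge> 0" for z
    by (simp add: f_def density_nonneg)
  ultimately have "AE z in lborel. enn2real (RN_deriv lborel (density lborel (\<lambda>z. ennreal (f z))) z) = f z"
    by (rule AE_lborel_RN_deriv_density)
  moreover have "density lborel (\<lambda>z. ennreal (f z)) = distr \<mu> lborel (coords2 X eP eG)"
    by (simp add: distr_\<mu> density_block f_def case_prod_unfold)
  ultimately have "AE z in lborel. joint_density X eP eG \<mu> z = f z"
    by (simp add: joint_density_def)
  then have "AE x in lborel. AE y in lborel. joint_density X eP eG \<mu> (x, y) = f (x, y)"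
    using lborel_pair.AE_pair[of "\<lambda>z. joint_density X eP eG \<mu> z = f z"] unfolding lborel_prod by blast
  with phys show ?thesis
  proof eventually_elim
    case (elim x)
    have pos: "gaussian_density mp A x > 0"
      by (rule gaussian_density_pos[OF pdA])
    have "(\<lambda>y. joint_density X eP eG \<mu> (x, y) / phys_density X eP \<mu> x) \<in> borel_measurable lborel"
      using measurable_Pair2[OF borel_measurable_gauge_density, of x] by simp
    moreover have "AE y in lborel. joint_density X eP eG \<mu> (x, y) / phys_density X eP \<mu> x
        = gaussian_density (mg + R *v (x - mp)) S y"
      using elim(2)
    proof eventually_elim
      case (elim y)
      with \<open>phys_density X eP \<mu> x = _\<close> pos show ?case
        by (simp add: f_def)
    qed
    then have "AE y in lborel. ennreal (joint_density X eP eG \<mu> (x, y) / phys_density X eP \<mu> x)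
        = ennreal (gaussian_density (mg + R *v (x - mp)) S y)"
      by eventually_elim simp
    ultimately show ?case
      unfolding gauge_conditional_def gaussian_def by (intro density_cong) auto
  qed
qed

end

theorem theorem4:
  fixes X :: "('m::t2_space, 'v::{finite,linorder}) triangulated_manifold"
    and eP :: "'p::finite \<Rightarrow> 'v cochain" and eG :: "'g::finite \<Rightarrow> 'v cochain"
    and \<mu> \<nu> :: "'v cochain measure"
    and m\<mu>p m\<nu>p :: "real ^ 'p" and m\<mu>g m\<nu>g d :: "real ^ 'g"
    and A\<mu> A\<nu> :: "real ^ 'p ^ 'p" and B\<mu> B\<nu> :: "real ^ 'g ^ 'p" and C\<mu> C\<nu> :: "real ^ 'g ^ 'g"
    and R\<mu> R\<nu> \<Delta>R :: "real ^ 'p ^ 'g" and S\<mu> S\<nu> :: "real ^ 'g ^ 'g"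
    and q :: nat
  assumes "closed_oriented_riemannian_3manifold_triangulated X"
    and "whitney_orthonormal_basis X (phys_space X) eP"
    and "whitney_orthonormal_basis X (gauge_space X) eG"
    and "q = dim (gauge_space X)"
    and "nondegenerate_gaussian X eP eG \<mu>
           (block_vec m\<mu>p m\<mu>g) (block_mat A\<mu> B\<mu> (transpose B\<mu>) C\<mu>)"
    and "nondegenerate_gaussian X eP eG \<nu>
           (block_vec m\<nu>p m\<nu>g) (block_mat A\<nu> B\<nu> (transpose B\<nu>) C\<nu>)"
    and "R\<mu> = transpose B\<mu> ** matrix_inv A\<mu>"
    and "R\<nu> = transpose B\<nu> ** matrix_inv A\<nu>"
    and "S\<mu> = C\<mu> - transpose B\<mu> ** matrix_inv A\<mu> ** B\<mu>"
    and "S\<nu> = C\<nu> - transpose B\<nu> ** matrix_inv A\<nu> ** B\<nu>"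
    and "\<Delta>R = R\<mu> - R\<nu>"
    and "d = m\<mu>g - m\<nu>g - R\<nu> *v (m\<mu>p - m\<nu>p)"
  shows "gauge_information_converges X eP eG \<mu> \<nu> \<and>
    conditional_gauge_information X eP eG \<mu> \<nu> =
      (trace (matrix_inv S\<nu> ** S\<mu>) - real q + ln (det S\<nu> / det S\<mu>)
        + d \<bullet> (matrix_inv S\<nu> *v d)
        + trace (matrix_inv S\<nu> ** \<Delta>R ** A\<mu> ** transpose \<Delta>R)) / 2"
proof -
  note X = assms(1) and eP = assms(2) and eG = assms(3) and \<mu> = assms(5) and \<nu> = assms(6)
  note \<mu>_data = X eP \<mu> assms(7) assms(9) and \<nu>_data = X eP \<nu> assms(8) assms(10)
  have pdA: "pos_def A\<mu>"
    using \<mu> by (auto simp: nondegenerate_gaussian_def intro: pos_def_block_mat_A)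
  have pdS: "pos_def S\<mu>" "pos_def S\<nu>"
    using pos_def_gauge_covariance[OF \<mu>_data] pos_def_gauge_covariance[OF \<nu>_data] by auto
  have sets_\<mu>: "sets \<mu> = sets (restrict_space borel (cochains X 1))"
    using \<mu> by (simp add: nondegenerate_gaussian_def)
  have q: "q = CARD('g)"
    using assms(4) dim_whitney_orthonormal_basis[OF X eG] by simp
  let ?P = "phys_marginal X \<mu>"
  let ?c\<mu> = "gauge_conditional X eP eG \<mu>" and ?c\<nu> = "gauge_conditional X eP eG \<nu>"
  let ?k = "trace (matrix_inv S\<nu> ** S\<mu>) - real q + ln (det S\<nu> / det S\<mu>)"
  let ?Q = "\<lambda>v. v \<bullet> (matrix_inv S\<nu> *v v)"
  let ?t = "trace (matrix_inv S\<nu> ** \<Delta>R ** A\<mu> ** transpose \<Delta>R)"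
  have coords: "coords X eP \<in> ?P \<rightarrow>\<^sub>M lborel"
    unfolding phys_marginal_def using measurable_coords_restrict[OF X refl] by simp
  have distr: "distr ?P lborel (coords X eP) = gaussian m\<mu>p A\<mu>"
    by (rule distr_phys_coords[OF \<mu>_data])
  \<comment> \<open>The exceptional set belonging to \<open>\<nu>\<close> is Lebesgue null, hence
    also null for the physical marginal of \<open>\<mu>\<close>, over which the outer integral
    runs.\<close>
  have cond: "AE x in gaussian m\<mu>p A\<mu>. ?c\<mu> x = gaussian (m\<mu>g + R\<mu> *v (x - m\<mu>p)) S\<mu> \<and>
      ?c\<nu> x = gaussian (m\<nu>g + R\<nu> *v (x - m\<nu>p)) S\<nu>"
    using AE_gauge_conditional[OF \<mu>_data] AE_gauge_conditional[OF \<nu>_data]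
    by (intro AE_gaussian_if_AE_lborel AE_conjI)
  \<comment> \<open>Recentring \<open>R\<nu> *v (x - m\<nu>p)\<close> at \<open>m\<mu>p\<close>
    leaves the constant \<open>R\<nu> *v (m\<mu>p - m\<nu>p)\<close>, which is the correction
    subtracted in \<open>d\<close>.\<close>
  have shift: "m\<mu>g + R\<mu> *v (x - m\<mu>p) - (m\<nu>g + R\<nu> *v (x - m\<nu>p)) = d + \<Delta>R *v (x - m\<mu>p)" for x
    by (simp add: assms(11,12) algebra_simps)
  have "AE x in gaussian m\<mu>p A\<mu>. integrable (?c\<mu> x) (entropy_density (exp 1) (?c\<nu> x) (?c\<mu> x))"
    using cond by eventually_elim (simp add: integrable.intros[OF gaussian_entropy_density[OF pdS]])
  \<comment> \<open>Statements proved in coordinates are pulled back to cochains along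
    \<open>coords X eP\<close>, whose image measure is the Gaussian.\<close>
  then have conv: "AE a in ?P. integrable (?c\<mu> (coords X eP a))
      (entropy_density (exp 1) (?c\<nu> (coords X eP a)) (?c\<mu> (coords X eP a)))"
    unfolding distr[symmetric] by (rule AE_distrD[OF coords])
  have ent: "AE x in gaussian m\<mu>p A\<mu>. relative_entropy (?c\<mu> x) (?c\<nu> x)
      = 1 / 2 * (?k + ?Q (d + \<Delta>R *v (x - m\<mu>p)))"
    using cond by eventually_elim (simp add: relative_entropy_gaussian[OF pdS] shift q)
  interpret prob_space "gaussian m\<mu>p A\<mu>"
    using pdA by (rule prob_space_gaussian)
  have k: "has_bochner_integral (gaussian m\<mu>p A\<mu>) (\<lambda>_. ?k) ?k"
    using prob_space by (simp add: has_bochner_integral_iff)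
  have "has_bochner_integral (gaussian m\<mu>p A\<mu>)
      (\<lambda>x. 1 / 2 * (?k + ?Q (d + \<Delta>R *v (x - m\<mu>p)))) (1 / 2 * (?k + (?Q d + ?t)))"
    by (intro has_bochner_integral_mult_right)
      (rule has_bochner_integral_add[OF k gaussian_affine_quadratic[OF pdA]])
  moreover have meas: "(\<lambda>x. relative_entropy (?c\<mu> x) (?c\<nu> x)) \<in> borel_measurable lborel"
    using borel_measurable_relative_entropy_gauge by simp
  ultimately have "has_bochner_integral (distr ?P lborel (coords X eP))
      (\<lambda>x. relative_entropy (?c\<mu> x) (?c\<nu> x)) (1 / 2 * (?k + (?Q d + ?t)))"
    unfolding distr using ent by (subst has_bochner_integral_cong_AE) auto
  then have "has_bochner_integral ?P
      (\<lambda>a. relative_entropy (?c\<mu> (coords X eP a)) (?c\<nu> (coords X eP a))) (1 / 2 * (?k + (?Q d + ?t)))"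
    by (simp add: has_bochner_integral_iff integrable_distr_eq[OF coords meas] integral_distr[OF coords meas])
  then show ?thesis
    using conv by (simp add: gauge_information_converges_def conditional_gauge_information_def
        has_bochner_integral_iff add.assoc)
qed

end
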